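(* Let $T$ be a nonempty set with $0\notin T$, let $f_0,f_t:\mathbb{R}^n\to\mathbb{R}\cup\{+\infty\}$, $t\in T$, be proper convex functions, and let $f:=\sup_{t\in T}f_t$. Let $\bar x$ be an optimal solution of the problem $$(\mathcal{P}):\quad\operatorname{Inf}\ f_0(x)\quad\text{subject to } f_t(x)\le0,\ t\in T,$$ such that $f(\bar x)=0$. Then $$0_n\in\operatorname{co}\left\{\partial(f_0+\mathrm{I}_{\operatorname{dom}f})(\bar x)\cup\bigcap_{\varepsilon>0}\operatorname{cl}\left(\bigcup_{t\in T_\varepsilon(\bar x)}\partial_\varepsilon(f_t+\mathrm{I}_{\operatorname{dom}f\cap\operatorname{dom}f_0})(\bar x)\right)\right\}.$$ Moreover, if the Slater condition holds, that is, $f(x_0)<0$ for some $x_0\in\operatorname{dom}f_0$, then $$0_n\in\partial(f_0+\mathrm{I}_{\operatorname{dom}f})(\bar x)+\operatorname{cone}\bigcap_{\varepsilon>0}\operatorname{cl}\left(\bigcup_{t\in T_\varepsilon(\bar x)}\partial_\varepsilon(f_t+\mathrm{I}_{\operatorname{dom}f\cap\operatorname{dom}f_0})(\bar x)\right)$$ and, provided in addition that $f$ is continuous at some point in $\operatorname{dom}f_0\cap\operatorname{dom}f$, $$0_n\in\partial f_0(\bar x)+\operatorname{cone}\bigcap_{\varepsilon>0}\operatorname{cl}\left(\bigcup_{t\in T_\varepsilon(\bar x)}\partial_\varepsilon f_t(\bar x)\right)+\mathrm{N}_{\operatorname{dom}f}(\bar x).$$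
   Context: $0_n$ is the zero vector of $\mathbb{R}^n$. For $h:\mathbb{R}^n\to\mathbb{R}\cup\{+\infty\}$, $\operatorname{dom}h=\{x:h(x)<+\infty\}$; $h$ is proper if $\operatorname{dom}h\ne\emptyset$. For $\varepsilon\ge0$, $\partial_\varepsilon h(x)=\{x^*\in\mathbb{R}^n: h(y)\ge h(x)+\langle x^*,y-x\rangle-\varepsilon\ \forall y\in\mathbb{R}^n\}$ if $h(x)\in\mathbb{R}$, and $\emptyset$ otherwise; $\partial h=\partial_0h$. $\mathrm{I}_A$ is the indicator function ($0$ on $A$, $+\infty$ off $A$). $\mathrm{N}_A(x)=\{x^*:\langle x^*,z-x\rangle\le0\ \forall z\in A\}$ if $x\in A$, and $\emptyset$ otherwise. $T_\varepsilon(\bar x)=\{t\in T:f_t(\bar x)\ge f(\bar x)-\varepsilon\}$. $\operatorname{co}$ is the convex hull, $\operatorname{cl}$ the closure, and $\operatorname{cone}A=\mathbb{R}_+\operatorname{co}A$ is the conical convex hull, with the convention $\mathbb{R}_+\emptyset=\{0_n\}$, so $\operatorname{cone}\emptyset=\{0_n\}$. An optimal solution of $(\mathcal{P})$ is a feasible point (a point satisfying all the constraints $f_t(\cdot)\le0$, $t\in T$) at which $f_0$ attains its minimum over the set of feasible points.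
   Formalization: An optimal solution is required to have a finite value of f_0 (it lies in dom f_0); if f_0 is +∞ at every feasible point, both sets in the first inclusion are empty and the claim fails. *)

theory Defs
  imports "HOL-Analysis.Analysis"
begin

text \<open>
  Functions with values in \<open>\<real> \<union> {+\<infinity>}\<close> are modelled as \<open>ereal\<close>-valued functions; the absence
  of the value \<open>-\<infinity>\<close> is part of \<open>proper_fun\<close>.
\<close>

definition edom :: "('a \<Rightarrow> ereal) \<Rightarrow> 'a set" where
  "edom h = {x. h x < \<infinity>}"

definition proper_fun :: "('a \<Rightarrow> ereal) \<Rightarrow> bool" where
  "proper_fun h \<longleftrightarrow> (\<forall>x. h x \<noteq> -\<infinity>) \<and> edom h \<noteq> {}"

text \<open>
  The boundary weights are harmless: \<open>0 * \<infinity> = 0\<close> in \<open>ereal\<close>, so for \<open>u = 0\<close> or \<open>v = 0\<close> the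
  inequality is trivially true.
\<close>

definition convex_fun :: "('a::real_vector \<Rightarrow> ereal) \<Rightarrow> bool" where
  "convex_fun h \<longleftrightarrow> (\<forall>x y. \<forall>u\<ge>0. \<forall>v\<ge>0. u + v = 1 \<longrightarrow>
     h (u *\<^sub>R x + v *\<^sub>R y) \<le> ereal u * h x + ereal v * h y)"

definition ind_fun :: "'a set \<Rightarrow> 'a \<Rightarrow> ereal" where
  "ind_fun A x = (if x \<in> A then 0 else \<infinity>)"

definition eps_subdiff :: "real \<Rightarrow> ('a::real_inner \<Rightarrow> ereal) \<Rightarrow> 'a \<Rightarrow> 'a set" where
  "eps_subdiff \<epsilon> h x =
     (if \<bar>h x\<bar> \<noteq> \<infinity> then {s. \<forall>y. h y \<ge> h x + ereal (s \<bullet> (y - x)) - ereal \<epsilon>} else {})"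

definition subdiff :: "('a::real_inner \<Rightarrow> ereal) \<Rightarrow> 'a \<Rightarrow> 'a set" where
  "subdiff h x = eps_subdiff 0 h x"

definition normal_cone :: "'a::real_inner set \<Rightarrow> 'a \<Rightarrow> 'a set" where
  "normal_cone A x = (if x \<in> A then {s. \<forall>z\<in>A. s \<bullet> (z - x) \<le> 0} else {})"

definition conical_hull :: "'a::real_vector set \<Rightarrow> 'a set" where
  "conical_hull A = (if A = {} then {0} else {c *\<^sub>R x | c x. 0 \<le> c \<and> x \<in> convex hull A})"

lemma conical_hull_eq: "conical_hull A = convex_cone hull A"
proof (cases "A = {}")
  case True
  then show ?thesis
    by (simp add: conical_hull_def)
next
  case False
  let ?C = "{c *\<^sub>R x | c x. 0 \<le> c \<and> x \<in> convex hull A}"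
  have eq: "?C = cone hull (convex hull A)"
    by (simp add: cone_hull_expl)
  have "convex ?C"
    unfolding eq by (intro convex_cone_hull convex_convex_hull)
  moreover have "conic ?C"
    unfolding conic_def by (auto simp: scaleR_scaleR) (metis mult_nonneg_nonneg)
  moreover have "?C \<noteq> {}"
    using False by (auto intro: hull_inc)
  ultimately have "convex_cone ?C"
    by (simp add: convex_cone_def)
  moreover have "A \<subseteq> ?C"
    by (force intro: hull_inc exI[of _ 1])
  ultimately have "convex_cone hull A \<subseteq> ?C"
    by (simp add: hull_minimal)
  moreover have "?C \<subseteq> convex_cone hull A"
    using convex_hull_subset_convex_cone_hull[of A] by (auto intro: convex_cone_hull_mul)
  ultimately show ?thesis
    using False by (auto simp: conical_hull_def)
qed

definition sup_fun :: "'i set \<Rightarrow> ('i \<Rightarrow> 'a \<Rightarrow> ereal) \<Rightarrow> 'a \<Rightarrow> ereal" where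
  "sup_fun T f x = (SUP t\<in>T. f t x)"

definition active_set :: "'i set \<Rightarrow> ('i \<Rightarrow> 'a \<Rightarrow> ereal) \<Rightarrow> real \<Rightarrow> 'a \<Rightarrow> 'i set" where
  "active_set T f \<epsilon> x = {t \<in> T. f t x \<ge> sup_fun T f x - ereal \<epsilon>}"

definition feasible_set :: "'i set \<Rightarrow> ('i \<Rightarrow> 'a \<Rightarrow> ereal) \<Rightarrow> 'a set" where
  "feasible_set T f = {x. \<forall>t\<in>T. f t x \<le> 0}"

text \<open>
  Attaining the minimum includes that the minimal value is finite: when the objective is
  identically \<open>+\<infinity>\<close> on the feasible set, no point is an optimal solution.
\<close>

definition optimal_solution ::
  "'i set \<Rightarrow> ('a \<Rightarrow> ereal) \<Rightarrow> ('i \<Rightarrow> 'a \<Rightarrow> ereal) \<Rightarrow> 'a \<Rightarrow> bool" where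
  "optimal_solution T f0 f x \<longleftrightarrow>
     x \<in> feasible_set T f \<and> x \<in> edom f0 \<and> (\<forall>y\<in>feasible_set T f. f0 x \<le> f0 y)"

end

theory Submission
  imports Defs
begin

text \<open>
  Subtracting \<open>f0 xbar\<close> from the objective, optimality says that the supremum of the objective and
  all constraints is nonnegative and vanishes at \<open>xbar\<close>. By separation, \<open>(0, 0)\<close> is then a limit of
  convex combinations of pairs \<open>(s, a)\<close> such that \<open>y \<mapsto> s \<bullet> (y - xbar) - a\<close> is an affine minorant of
  the objective or of one of the constraints; here \<open>a \<ge> 0\<close>, so \<open>s\<close> is an \<open>a\<close>-subgradient. By
  Caratheodory's theorem the number of terms is bounded, and along a subsequence the terms whose
  weight stays positive converge to elements of the two sets in the theorem, while those whose
  weight tends to \<open>0\<close> leave only elements of normal cones. The Slater condition forces the weight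
  of the objective to be positive.
\<close>

section \<open>Affine minorants\<close>

text \<open>No lower semicontinuity is available, so affine minorants recover a convex function at
  relative interior points of its domain but perhaps not on the boundary. Separation yields a point
  that is only in the closures of the domains; it is moved slightly towards a \<open>z\<close> lying
  in all relative interiors at once. The second obstacle is that slopes with vanishing weight may
  blow up. Their weighted contributions stay bounded if normal vectors of the two domains involved
  cannot cancel nontrivially, which holds when one domain meets the interior of the other. For the
  last claim, continuity of \<open>F\<close> provides both \<open>z\<close> and this interior. For
  the other claims all functions live on \<open>edom F \<inter> edom f0\<close>; as this set may
  have empty interior, they are composed with an affine retraction onto its affine hull. Normal
  vectors of that common domain are then absorbed, since adding one to a slope preserves
  minorants.\<close>

lemma convex_on_subgradient_rel_interior:
  fixes g :: "'a::euclidean_space \<Rightarrow> real"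
  assumes "convex_on D g" and z: "z \<in> rel_interior D"
  obtains s where "\<And>y. y \<in> D \<Longrightarrow> g z + s \<bullet> (y - z) \<le> g y"
proof -
  let ?E = "epigraph D g"
  have cD: "convex D" and zD: "z \<in> D"
    using assms rel_interior_subset by (auto simp: convex_on_def)
  have cE: "convex ?E"
    using assms(1) by (simp add: convex_epigraph)
  have inE: "(z, g z) \<in> ?E"
    using zD by (simp add: mem_epigraph)
  \<comment> \<open>Otherwise the vertical segment from \<open>(z, g z + 1)\<close> could be
    prolonged downwards past \<open>(z, g z)\<close> inside the epigraph.\<close>
  have "(z, g z) \<notin> rel_interior ?E"
  proof
    assume "(z, g z) \<in> rel_interior ?E"
    moreover have "(z, g z + 1) \<in> ?E"
      using zD by (simp add: mem_epigraph)
    ultimately obtain e where "e > 1" "(1 - e) *\<^sub>R (z, g z + 1) + e *\<^sub>R (z, g z) \<in> ?E"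
      using convex_rel_interior_iff[OF cE] inE by (metis empty_iff)
    then have "g ((1 - e) *\<^sub>R z + e *\<^sub>R z) \<le> (1 - e) * (g z + 1) + e * g z"
      by (simp add: mem_epigraph)
    moreover have "(1 - e) *\<^sub>R z + e *\<^sub>R z = z"
      by (simp flip: scaleR_left.add)
    ultimately show False
      using \<open>e > 1\<close> by (simp add: algebra_simps)
  qed
  then obtain a where le: "\<And>p. p \<in> ?E \<Longrightarrow> a \<bullet> (z, g z) \<le> a \<bullet> p"
    and less: "\<And>p. p \<in> rel_interior ?E \<Longrightarrow> a \<bullet> (z, g z) < a \<bullet> p"
    using supporting_hyperplane_rel_boundary[OF cE inE] by metis
  obtain s b where a: "a = (s, b)"
    by fastforce
  have sup: "s \<bullet> z + b * g z \<le> s \<bullet> y + b * r" if "y \<in> D" "g y \<le> r" for y r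
    using le[of "(y, r)"] that by (simp add: a mem_epigraph)
  have "b \<ge> 0"
    using sup[OF zD, of "g z + 1"] by (simp add: algebra_simps)
  \<comment> \<open>A vertical hyperplane would be constant on \<open>D\<close>: segments in
    \<open>D\<close> ending at the relative interior point \<open>z\<close> extend beyond it, so a
    linear function minimal at \<open>z\<close> cannot vary. This contradicts strictness on the
    relative interior of the epigraph.\<close>
  moreover have "b \<noteq> 0"
  proof
    assume "b = 0"
    have const: "s \<bullet> y = s \<bullet> z" if y: "y \<in> D" for y
    proof -
      obtain e where e: "e > 1" "(1 - e) *\<^sub>R y + e *\<^sub>R z \<in> D"
        using convex_rel_interior_iff[OF cD] zD y z by (metis empty_iff)
      have "s \<bullet> z \<le> s \<bullet> ((1 - e) *\<^sub>R y + e *\<^sub>R z)"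
        using sup[OF e(2) order_refl] \<open>b = 0\<close> by simp
      then have "(e - 1) * (s \<bullet> y) \<le> (e - 1) * (s \<bullet> z)"
        by (simp add: inner_add_right algebra_simps)
      then have "s \<bullet> y \<le> s \<bullet> z"
        using e(1) by simp
      with sup[OF y order_refl] \<open>b = 0\<close> show ?thesis
        by simp
    qed
    obtain p where "p \<in> rel_interior ?E"
      using rel_interior_eq_empty[OF cE] inE by blast
    then have "s \<bullet> z < s \<bullet> fst p" "fst p \<in> D"
      using less[of p] rel_interior_subset[of ?E] \<open>b = 0\<close>
      by (auto simp: a inner_prod_def epigraph_def)
    then show False
      using const by fastforce
  qed
  ultimately have b: "b > 0"
    by simp
  show ?thesis
  proof (rule that[of "- (1 / b) *\<^sub>R s"])
    fix y assume "y \<in> D"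
    then have "b * g z - s \<bullet> (y - z) \<le> b * g y"
      using sup[of y "g y"] by (simp add: inner_diff_right)
    then show "g z + (- (1 / b) *\<^sub>R s) \<bullet> (y - z) \<le> g y"
      using b by (simp add: field_simps)
  qed
qed

text \<open>
  The epigraph of the Fenchel conjugate of \<open>g + I_D\<close> with \<open>x\<close> as the origin.
\<close>

definition affine_minorants :: "'a::real_inner set \<Rightarrow> ('a \<Rightarrow> real) \<Rightarrow> 'a \<Rightarrow> ('a \<times> real) set" where
  "affine_minorants D g x = {(s, a). \<forall>y\<in>D. s \<bullet> (y - x) - a \<le> g y}"

lemma affine_minorants_mono:
  assumes "(s, a) \<in> affine_minorants D g x" "a \<le> b"
  shows "(s, b) \<in> affine_minorants D g x"
  using assms by (fastforce simp: affine_minorants_def)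

lemma affine_minorants_nonneg:
  assumes "(s, a) \<in> affine_minorants D g x" "x \<in> D" "g x \<le> 0"
  shows "0 \<le> a"
  using assms by (fastforce simp: affine_minorants_def)

text \<open>The slope is a subgradient at \<open>z\<close>, and the offset makes the minorant touch
  the graph there.\<close>

lemma affine_minorants_exact:
  fixes g :: "'a::euclidean_space \<Rightarrow> real"
  assumes "convex_on D g" "z \<in> rel_interior D"
  obtains s where "(s, s \<bullet> (z - x) - g z) \<in> affine_minorants D g x"
proof -
  obtain s where "\<And>y. y \<in> D \<Longrightarrow> g z + s \<bullet> (y - z) \<le> g y"
    using convex_on_subgradient_rel_interior[OF assms] by metis
  then show ?thesis
    by (intro that[of s]) (force simp: affine_minorants_def inner_diff_right)
qed

lemma convex_affine_minorants: "convex (affine_minorants D g x)"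
proof (rule convexI)
  fix p q and u v :: real
  assume p: "p \<in> affine_minorants D g x" and q: "q \<in> affine_minorants D g x"
    and u: "0 \<le> u" and v: "0 \<le> v" and uv: "u + v = 1"
  obtain s a t b where pq: "p = (s, a)" "q = (t, b)"
    by (cases p, cases q)
  have "(u *\<^sub>R s + v *\<^sub>R t) \<bullet> (y - x) - (u * a + v * b) \<le> g y" if "y \<in> D" for y
  proof -
    have "u * (s \<bullet> (y - x) - a) + v * (t \<bullet> (y - x) - b) \<le> u * g y + v * g y"
      using p q that u v by (intro add_mono mult_left_mono) (auto simp: pq affine_minorants_def)
    also have "\<dots> = g y"
      using uv by (simp flip: distrib_right)
    finally show ?thesis
      by (simp add: inner_add_left algebra_simps)
  qed
  then show "u *\<^sub>R p + v *\<^sub>R q \<in> affine_minorants D g x"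
    by (simp add: pq affine_minorants_def)
qed

text \<open>Separating \<open>y\<close> from \<open>closure D\<close> gives an affine function that
  is negative on \<open>D\<close> and positive at \<open>y\<close>. Adding large multiples of it to
  one minorant yields minorants with unbounded values at \<open>y\<close>.\<close>

lemma mem_closure_if_affine_minorants_bounded:
  fixes g :: "'a::euclidean_space \<Rightarrow> real"
  assumes "convex D" and p: "(s, a) \<in> affine_minorants D g x"
    and bound: "\<And>s a. (s, a) \<in> affine_minorants D g x \<Longrightarrow> s \<bullet> (y - x) - a \<le> C"
  shows "y \<in> closure D"
proof (rule ccontr)
  assume "y \<notin> closure D"
  then obtain c b where c: "c \<bullet> y < b" and b: "\<And>z. z \<in> closure D \<Longrightarrow> b < c \<bullet> z"
    using separating_hyperplane_closed_point[of "closure D" y] \<open>convex D\<close>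
    by (metis closed_closure convex_closure)
  \<comment> \<open>Scaled so that the tilted minorant gains
    \<open>\<bar>C - (s \<bullet> (y - x) - a)\<bar> + 1\<close> at \<open>y\<close>, which lifts it
    above \<open>C\<close>.\<close>
  define k where "k = (\<bar>C - (s \<bullet> (y - x) - a)\<bar> + 1) / (b - c \<bullet> y)"
  have k: "k \<ge> 0"
    using c by (simp add: k_def)
  have "(s - k *\<^sub>R c, a - k * (b - c \<bullet> x)) \<in> affine_minorants D g x"
    unfolding affine_minorants_def
  proof safe
    fix z assume z: "z \<in> D"
    then have "b \<le> c \<bullet> z"
      using b[of z] closure_subset[of D] by auto
    then have "k * b \<le> k * (c \<bullet> z)"
      using k by (rule mult_left_mono)
    moreover have "s \<bullet> (z - x) - a \<le> g z"
      using p z by (simp add: affine_minorants_def)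
    ultimately show "(s - k *\<^sub>R c) \<bullet> (z - x) - (a - k * (b - c \<bullet> x)) \<le> g z"
      by (simp add: algebra_simps)
  qed
  from bound[OF this] have "s \<bullet> (y - x) - a + k * (b - c \<bullet> y) \<le> C"
    by (simp add: algebra_simps)
  moreover have "k * (b - c \<bullet> y) = \<bar>C - (s \<bullet> (y - x) - a)\<bar> + 1"
    using c by (simp add: k_def)
  ultimately show False
    by linarith
qed

text \<open>A hyperplane separating \<open>0\<close> from the hull amounts to a point
  \<open>y\<close> at which all minorants of all functions are at most some \<open>- c < 0\<close>.
  This bounds the lower semicontinuous hulls at \<open>y\<close>, not the \<open>g j\<close>
  themselves. A short move towards \<open>z\<close> reaches a point where the functions agree with
  these hulls, and the common bound \<open>M\<close> at \<open>z\<close> makes one step length work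
  for all \<open>j\<close>.\<close>

lemma zero_mem_closure_convex_hull_affine_minorants:
  fixes g :: "'i \<Rightarrow> 'a::euclidean_space \<Rightarrow> real"
  assumes conv: "\<And>j. j \<in> J \<Longrightarrow> convex_on (D j) (g j)"
    and x: "\<And>j. j \<in> J \<Longrightarrow> x \<in> D j" "\<And>j. j \<in> J \<Longrightarrow> g j x \<le> 0"
    and z: "\<And>j. j \<in> J \<Longrightarrow> z \<in> rel_interior (D j)" "\<And>j. j \<in> J \<Longrightarrow> g j z \<le> M"
    and sup: "\<And>y e. (\<And>j. j \<in> J \<Longrightarrow> y \<in> D j) \<Longrightarrow> 0 < e \<Longrightarrow> \<exists>j\<in>J. - e < g j y"
  shows "0 \<in> closure (convex hull (\<Union>j\<in>J. affine_minorants (D j) (g j) x))"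
proof (rule ccontr)
  let ?G = "\<Union>j\<in>J. affine_minorants (D j) (g j) x"
  assume "0 \<notin> closure (convex hull ?G)"
  with separating_hyperplane_closed_0[OF convex_closure[OF convex_convex_hull] closed_closure]
  obtain a b where b: "0 < b" and sep: "\<forall>p\<in>closure (convex hull ?G). b < a \<bullet> p"
    by blast
  have "?G \<subseteq> closure (convex hull ?G)"
    using hull_subset closure_subset by (rule subset_trans)
  with sep have a: "b < a \<bullet> p" if "p \<in> ?G" for p
    using that by blast
  obtain v \<beta> where v: "a = (v, \<beta>)"
    by fastforce
  \<comment> \<open>Second components are nonnegative on \<open>?G\<close>, so enlarging \<open>\<beta>\<close> to a positive number keeps the separation.\<close>
  define \<gamma> where "\<gamma> = \<bar>\<beta>\<bar> + 1"
  define y where "y = x - (1 / \<gamma>) *\<^sub>R v"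
  define c where "c = b / \<gamma>"
  have \<gamma>: "\<gamma> > 0" "\<beta> \<le> \<gamma>" and c: "c > 0"
    using b by (auto simp: \<gamma>_def c_def)
  have low: "s \<bullet> (y - x) - \<alpha> \<le> - c" if j: "j \<in> J" and m: "(s, \<alpha>) \<in> affine_minorants (D j) (g j) x" for j s \<alpha>
  proof -
    have "\<alpha> \<ge> 0"
      using affine_minorants_nonneg[OF m] x j by simp
    then have "\<beta> * \<alpha> \<le> \<gamma> * \<alpha>"
      using \<gamma> by (intro mult_right_mono)
    moreover have "b < v \<bullet> s + \<beta> * \<alpha>"
      using a[of "(s, \<alpha>)"] j m by (auto simp: v)
    ultimately have "b \<le> s \<bullet> v + \<gamma> * \<alpha>"
      by (simp add: inner_commute)
    then have "b / \<gamma> \<le> (s \<bullet> v + \<gamma> * \<alpha>) / \<gamma>"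
      using \<gamma>(1) by (intro divide_right_mono) auto
    then show ?thesis
      using \<gamma>(1) by (simp add: y_def c_def add_divide_distrib)
  qed
  have y: "y \<in> closure (D j)" if j: "j \<in> J" for j
  proof -
    obtain s where "(s, s \<bullet> (z - x) - g j z) \<in> affine_minorants (D j) (g j) x"
      using affine_minorants_exact[OF conv z(1)] j by metis
    then show ?thesis
      using mem_closure_if_affine_minorants_bounded[of "D j", OF _ _ low[OF j]] conv[OF j]
      by (auto simp: convex_on_def)
  qed
  \<comment> \<open>The step length balances the possible loss at \<open>z\<close> against the gain
    at \<open>y\<close>: it keeps \<open>(1 - e) * (- c) + e * M\<close> at or below
    \<open>- (c / 2)\<close>.\<close>
  define e where "e = c / (2 * (\<bar>M\<bar> + c))"
  have e: "0 < e" "e \<le> 1" and eM: "e * (\<bar>M\<bar> + c) = c / 2"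
    using c by (auto simp: e_def field_simps)
  have "e * (M + c) \<le> e * (\<bar>M\<bar> + c)"
    using e by (intro mult_left_mono) auto
  then have eM': "e * M + e * c \<le> c / 2"
    using eM by (simp add: algebra_simps)
  define w where "w = y - e *\<^sub>R (y - z)"
  have w: "w \<in> rel_interior (D j)" if "j \<in> J" for j
    unfolding w_def using conv[OF that] z(1)[OF that] y[OF that] e
    by (intro rel_interior_closure_convex_shrink) (auto simp: convex_on_def)
  have "g j w \<le> - (c / 2)" if j: "j \<in> J" for j
  proof -
    obtain s where s: "(s, s \<bullet> (w - x) - g j w) \<in> affine_minorants (D j) (g j) x"
      using affine_minorants_exact[OF conv w] j by metis
    have "s \<bullet> (y - w) + g j w \<le> - c"
      using low[OF j s] by (simp add: algebra_simps)
    moreover have "z \<in> D j"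
      using z(1)[OF j] rel_interior_subset by blast
    then have "s \<bullet> (z - w) + g j w \<le> M"
      using s z(2)[OF j] by (fastforce simp: affine_minorants_def algebra_simps)
    ultimately have "(1 - e) * (s \<bullet> (y - w) + g j w) + e * (s \<bullet> (z - w) + g j w) \<le> (1 - e) * (- c) + e * M"
      using e by (intro add_mono mult_left_mono) auto
    \<comment> \<open>\<open>w\<close> is the combination of \<open>y\<close> and \<open>z\<close>
      with weights \<open>1 - e\<close> and \<open>e\<close>, so the slope terms cancel and only
      \<open>g j w\<close> survives.\<close>
    moreover have "(1 - e) * (s \<bullet> (y - w)) + e * (s \<bullet> (z - w)) = 0"
    proof -
      have "(1 - e) *\<^sub>R (y - w) + e *\<^sub>R (z - w) = 0"
        by (simp add: w_def algebra_simps)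
      then have "s \<bullet> ((1 - e) *\<^sub>R (y - w) + e *\<^sub>R (z - w)) = 0"
        by simp
      then show ?thesis
        unfolding inner_add_right inner_scaleR_right .
    qed
    moreover have "(1 - e) * (A + C) + e * (B + C) = ((1 - e) * A + e * B) + C" for A B C :: real
      by (simp add: algebra_simps)
    ultimately have "g j w \<le> (1 - e) * (- c) + e * M"
      by simp
    then show ?thesis
      using eM' by (simp add: algebra_simps)
  qed
  moreover have "\<exists>j\<in>J. - (c / 2) < g j w"
    using w c rel_interior_subset by (intro sup) auto
  ultimately show False
    by fastforce
qed

section \<open>Limits of convex combinations of minorants\<close>

text \<open>Padding with zero weights fixes the number of terms, so that limits of sequences of
  combinations can be taken term by term.\<close>

lemma convex_hull_caratheodory_indexed:
  fixes S :: "'a::euclidean_space set"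
  assumes "y \<in> convex hull S"
  obtains u q where "\<And>i. i < DIM('a) + 1 \<Longrightarrow> 0 \<le> u i" "\<And>i. q i \<in> S"
    "sum u {..<DIM('a) + 1} = 1" "(\<Sum>i<DIM('a) + 1. u i *\<^sub>R q i) = y"
proof -
  obtain A w where A: "finite A" "A \<subseteq> S" "card A \<le> DIM('a) + 1" "\<forall>x\<in>A. 0 \<le> w x"
    "sum w A = 1" "(\<Sum>x\<in>A. w x *\<^sub>R x) = y"
    using assms unfolding convex_hull_caratheodory by blast
  obtain h where h: "bij_betw h {..<card A} A"
    using ex_bij_betw_nat_finite[OF A(1)] by (auto simp: atLeast0LessThan)
  obtain p where p: "p \<in> S"
    using A(2,5) by (cases "A = {}") auto
  define u where "u i = (if i < card A then w (h i) else 0)" for i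
  define q where "q i = (if i < card A then h i else p)" for i
  have sub: "{..<card A} \<subseteq> {..<DIM('a) + 1}"
    using A(3) by auto
  show ?thesis
  proof
    show "0 \<le> u i" for i
      using A(4) bij_betwE[OF h] by (auto simp: u_def)
    show "q i \<in> S" for i
      using A(2) bij_betwE[OF h] p by (auto simp: q_def)
    have "sum u {..<DIM('a) + 1} = (\<Sum>i<card A. w (h i))"
      using sub by (intro sum.mono_neutral_cong_right) (auto simp: u_def)
    also have "\<dots> = 1"
      using sum.reindex_bij_betw[OF h, of w] A(5) by simp
    finally show "sum u {..<DIM('a) + 1} = 1" .
    have "(\<Sum>i<DIM('a) + 1. u i *\<^sub>R q i) = (\<Sum>i<card A. w (h i) *\<^sub>R h i)"
      using sub by (intro sum.mono_neutral_cong_right) (auto simp: u_def q_def)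
    also have "\<dots> = y"
      using sum.reindex_bij_betw[OF h, of "\<lambda>x. w x *\<^sub>R x"] A(6) by simp
    finally show "(\<Sum>i<DIM('a) + 1. u i *\<^sub>R q i) = y" .
  qed
qed

lemma bounded_family_convergent_subsequence:
  fixes X :: "nat \<Rightarrow> 'i \<Rightarrow> 'a::heine_borel"
  assumes "finite I" "\<And>i. i \<in> I \<Longrightarrow> bounded (range (\<lambda>k. X k i))"
  shows "\<exists>r l. strict_mono (r :: nat \<Rightarrow> nat) \<and> (\<forall>i\<in>I. (\<lambda>k. X (r k) i) \<longlonglongrightarrow> l i)"
  using assms
proof (induction I rule: finite_induct)
  case empty
  then show ?case
    using strict_mono_id by auto
next
  case (insert j I)
  then obtain r l where r: "strict_mono (r :: nat \<Rightarrow> nat)" "\<And>i. i \<in> I \<Longrightarrow> (\<lambda>k. X (r k) i) \<longlonglongrightarrow> l i"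
    by auto
  have "bounded (range (\<lambda>k. X (r k) j))"
    using bounded_subset[OF insert.prems[of j], of "range (\<lambda>k. X (r k) j)"] by auto
  then obtain r' m where r': "strict_mono (r' :: nat \<Rightarrow> nat)" "((\<lambda>k. X (r k) j) \<circ> r') \<longlonglongrightarrow> m"
    using bounded_imp_convergent_subsequence by blast
  have "strict_mono (r \<circ> r')"
    using r(1) r'(1) by (rule strict_mono_o)
  moreover have "(\<lambda>k. X ((r \<circ> r') k) i) \<longlonglongrightarrow> (l(j := m)) i" if "i \<in> insert j I" for i
    using that insert.hyps r'(2) LIMSEQ_subseq_LIMSEQ[OF r(2) r'(1), of i] by (auto simp: o_def)
  ultimately show ?case
    by blast
qed

text \<open>The slopes \<open>s k i\<close> may diverge when \<open>u k i\<close> tends to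
  \<open>0\<close>; only the products \<open>u k i *\<^sub>R s k i\<close> are controlled. For a
  positive limit weight the slope converges as well. For a vanishing one, multiplying
  \<open>bound\<close> by the weight and passing to the limit leaves a normal vector of
  \<open>R i\<close>, the set on which the minorants are bounded independently of
  \<open>k\<close>.\<close>

lemma affine_minorant_combination_limit:
  fixes s :: "nat \<Rightarrow> 'i \<Rightarrow> 'a::euclidean_space" and c :: "nat \<Rightarrow> 'i \<Rightarrow> real"
  assumes fin: "finite I"
    and x: "\<And>i. i \<in> I \<Longrightarrow> x \<in> R i"
    and bound: "\<And>k i y. i \<in> I \<Longrightarrow> y \<in> R i \<Longrightarrow> s k i \<bullet> (y - x) - c k i \<le> M i y"
    and c: "\<And>k i. i \<in> I \<Longrightarrow> 0 \<le> c k i"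
    and u: "\<And>k i. i \<in> I \<Longrightarrow> 0 \<le> u k i" "\<And>k. sum (u k) I = 1"
    and lim: "(\<lambda>k. \<Sum>i\<in>I. u k i *\<^sub>R s k i) \<longlonglongrightarrow> 0" "(\<lambda>k. \<Sum>i\<in>I. u k i * c k i) \<longlonglongrightarrow> 0"
    and qual: "\<And>w. (\<And>i. i \<in> I \<Longrightarrow> w i \<in> normal_cone (R i) x) \<Longrightarrow> sum w I = 0 \<Longrightarrow> \<forall>i\<in>I. w i = 0"
  obtains r v b n where "strict_mono (r :: nat \<Rightarrow> nat)"
    "\<And>i. i \<in> I \<Longrightarrow> 0 \<le> v i" "sum v I = (1::real)"
    "(\<Sum>i\<in>I. v i *\<^sub>R b i + n i) = 0"
    "\<And>i. i \<in> I \<Longrightarrow> n i \<in> normal_cone (R i) x"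
    "\<And>i. i \<in> I \<Longrightarrow> 0 < v i \<Longrightarrow> (\<lambda>k. s (r k) i) \<longlonglongrightarrow> b i"
    "\<And>i. i \<in> I \<Longrightarrow> 0 < v i \<Longrightarrow> (\<lambda>k. c (r k) i) \<longlonglongrightarrow> 0"
proof -
  \<comment> \<open>Normalizing the terms \<open>u k i *\<^sub>R s k i\<close>: if they were unbounded, the normalized ones would tend to
    normal vectors that sum to \<open>0\<close> without all vanishing, against \<open>qual\<close>.\<close>
  define \<rho> where "\<rho> k = 1 / (1 + (\<Sum>i\<in>I. norm (u k i *\<^sub>R s k i)))" for k
  define w where "w k i = \<rho> k *\<^sub>R (u k i *\<^sub>R s k i)" for k i
  have N: "0 \<le> (\<Sum>i\<in>I. norm (u k i *\<^sub>R s k i))" for k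
    by (simp add: sum_nonneg)
  then have \<rho>: "0 < \<rho> k" "\<rho> k \<le> 1" for k
    by (auto simp: \<rho>_def add_pos_nonneg)
  have wsum: "(\<Sum>i\<in>I. norm (w k i)) = 1 - \<rho> k" for k
  proof -
    have "(\<Sum>i\<in>I. norm (w k i)) = \<rho> k * (\<Sum>i\<in>I. norm (u k i *\<^sub>R s k i))"
      using \<rho>(1)[of k] by (simp add: w_def sum_distrib_left abs_mult mult_ac less_imp_le)
    also have "\<dots> = 1 - \<rho> k"
      using N[of k] by (simp add: \<rho>_def field_simps)
    finally show ?thesis .
  qed
  have wle: "norm (w k i) \<le> 1" if "i \<in> I" for k i
  proof -
    have "norm (w k i) \<le> (\<Sum>i\<in>I. norm (w k i))"
      using that fin by (intro member_le_sum) auto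
    then show ?thesis
      using wsum[of k] \<rho>(1)[of k] by simp
  qed
  have ule: "\<bar>u k i\<bar> \<le> 1" if "i \<in> I" for k i
    using member_le_sum[of i I "u k"] that fin u by auto
  have "bounded (range (\<lambda>k. (w k i, u k i, \<rho> k)))" if "i \<in> I" for i
  proof -
    have "range (\<lambda>k. (w k i, u k i, \<rho> k)) \<subseteq> cball 0 1 \<times> cball 0 1 \<times> cball 0 1"
      using wle ule \<rho> that by (auto simp: less_imp_le)
    then show ?thesis
      by (rule bounded_subset[rotated]) (intro bounded_Times bounded_cball)
  qed
  then obtain r l where r: "strict_mono (r :: nat \<Rightarrow> nat)"
    and l: "\<And>i. i \<in> I \<Longrightarrow> (\<lambda>k. (w (r k) i, u (r k) i, \<rho> (r k))) \<longlonglongrightarrow> l i"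
    using bounded_family_convergent_subsequence[OF fin, of "\<lambda>k i. (w k i, u k i, \<rho> k)"] by blast
  have sub: "(\<lambda>k. X (r k)) \<longlonglongrightarrow> L" if "X \<longlonglongrightarrow> L" for X :: "nat \<Rightarrow> 'b::topological_space" and L
    using LIMSEQ_subseq_LIMSEQ[OF that r] by (simp add: o_def)
  define W where "W i = fst (l i)" for i
  define v where "v i = fst (snd (l i))" for i
  have W: "(\<lambda>k. w (r k) i) \<longlonglongrightarrow> W i" and v: "(\<lambda>k. u (r k) i) \<longlonglongrightarrow> v i" if "i \<in> I" for i
    using tendsto_fst[OF l[OF that]] tendsto_fst[OF tendsto_snd[OF l[OF that]]]
    by (simp_all add: W_def v_def)
  have "I \<noteq> {}"
    using u(2)[of 0] by auto
  then obtain R0 where R0: "(\<lambda>k. \<rho> (r k)) \<longlonglongrightarrow> R0"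
    using tendsto_snd[OF tendsto_snd[OF l]] by fastforce
  have R0_nonneg: "0 \<le> R0"
    using R0 \<rho>(1) by (intro LIMSEQ_le_const[OF R0]) (auto simp: less_imp_le)
  have v_nonneg: "0 \<le> v i" if "i \<in> I" for i
    using u(1)[OF that] by (intro LIMSEQ_le_const[OF v[OF that]]) auto
  have v_sum: "sum v I = 1"
  proof -
    have "(\<lambda>k. sum (u (r k)) I) \<longlonglongrightarrow> sum v I"
      using v by (rule tendsto_sum)
    then show ?thesis
      using u(2) by (simp add: LIMSEQ_const_iff)
  qed
  have W_norm: "(\<Sum>i\<in>I. norm (W i)) = 1 - R0"
  proof (rule LIMSEQ_unique)
    show "(\<lambda>k. \<Sum>i\<in>I. norm (w (r k) i)) \<longlonglongrightarrow> (\<Sum>i\<in>I. norm (W i))"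
      by (intro tendsto_sum tendsto_norm W)
    show "(\<lambda>k. \<Sum>i\<in>I. norm (w (r k) i)) \<longlonglongrightarrow> 1 - R0"
      unfolding wsum by (intro tendsto_diff tendsto_const R0)
  qed
  have W_sum: "sum W I = 0"
  proof (rule LIMSEQ_unique)
    show "(\<lambda>k. sum (w (r k)) I) \<longlonglongrightarrow> sum W I"
      by (intro tendsto_sum W)
    have "(\<lambda>k. \<rho> (r k) *\<^sub>R (\<Sum>i\<in>I. u (r k) i *\<^sub>R s (r k) i)) \<longlonglongrightarrow> R0 *\<^sub>R 0"
      by (intro tendsto_scaleR R0 sub[OF lim(1)])
    then show "(\<lambda>k. sum (w (r k)) I) \<longlonglongrightarrow> 0"
      by (simp add: w_def scaleR_sum_right)
  qed
  \<comment> \<open>All summands are nonnegative, so each is squeezed between \<open>0\<close> and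
    the whole sum.\<close>
  have uc: "(\<lambda>k. u k i * c k i) \<longlonglongrightarrow> 0" if i: "i \<in> I" for i
  proof (rule tendsto_sandwich[OF _ _ tendsto_const lim(2)])
    show "\<forall>\<^sub>F k in sequentially. 0 \<le> u k i * c k i"
      using u(1) c i by simp
    show "\<forall>\<^sub>F k in sequentially. u k i * c k i \<le> (\<Sum>i\<in>I. u k i * c k i)"
      using fin u(1) c i by (intro always_eventually allI member_le_sum[of i I]) auto
  qed
  \<comment> \<open>Used twice: with \<open>R0 = 0\<close> it makes \<open>W i\<close> a normal
    vector, and after division by a positive \<open>R0\<close> it makes the limit of the
    unnormalized term normal whenever \<open>v i = 0\<close>.\<close>
  have W_le: "W i \<bullet> (y - x) \<le> R0 * (v i * M i y)" if i: "i \<in> I" and y: "y \<in> R i" for i y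
  proof (rule LIMSEQ_le)
    show "(\<lambda>k. w (r k) i \<bullet> (y - x) - \<rho> (r k) * (u (r k) i * c (r k) i)) \<longlonglongrightarrow> W i \<bullet> (y - x)"
      using tendsto_diff[OF tendsto_inner[OF W[OF i] tendsto_const[of "y - x"]]
          tendsto_mult[OF R0 sub[OF uc[OF i]]]] by simp
    show "(\<lambda>k. \<rho> (r k) * (u (r k) i * M i y)) \<longlonglongrightarrow> R0 * (v i * M i y)"
      by (intro tendsto_intros R0 v i)
    have "w k i \<bullet> (y - x) - \<rho> k * (u k i * c k i) \<le> \<rho> k * (u k i * M i y)" for k
    proof -
      have "\<rho> k * (u k i * (s k i \<bullet> (y - x) - c k i)) \<le> \<rho> k * (u k i * M i y)"
        using bound[OF i y] u(1)[OF i] \<rho>(1)[of k] by (intro mult_left_mono) (auto simp: less_imp_le)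
      then show ?thesis
        by (simp add: w_def algebra_simps)
    qed
    then show "\<exists>N. \<forall>n\<ge>N. w (r n) i \<bullet> (y - x) - \<rho> (r n) * (u (r n) i * c (r n) i) \<le> \<rho> (r n) * (u (r n) i * M i y)"
      by blast
  qed
  have "R0 \<noteq> 0"
  proof
    assume "R0 = 0"
    then have "W i \<in> normal_cone (R i) x" if "i \<in> I" for i
      using W_le[OF that] x[OF that] by (simp add: normal_cone_def)
    with W_sum have "\<forall>i\<in>I. W i = 0"
      using qual by blast
    with W_norm \<open>R0 = 0\<close> show False
      by simp
  qed
  with R0_nonneg have R0_pos: "0 < R0"
    by simp
  define q where "q i = (1 / R0) *\<^sub>R W i" for i
  have q_lim: "(\<lambda>k. u (r k) i *\<^sub>R s (r k) i) \<longlonglongrightarrow> q i" if "i \<in> I" for i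
  proof -
    have "(\<lambda>k. (1 / \<rho> (r k)) *\<^sub>R w (r k) i) \<longlonglongrightarrow> (1 / R0) *\<^sub>R W i"
      using R0_pos by (intro tendsto_scaleR tendsto_divide tendsto_const R0 W that) auto
    moreover have "(1 / \<rho> (r k)) *\<^sub>R w (r k) i = u (r k) i *\<^sub>R s (r k) i" for k
      using \<rho>(1)[of "r k"] by (simp add: w_def)
    ultimately show ?thesis
      by (simp add: q_def)
  qed
  have q_le: "q i \<bullet> (y - x) \<le> v i * M i y" if "i \<in> I" "y \<in> R i" for i y
    using W_le[OF that] R0_pos by (simp add: q_def field_simps)
  \<comment> \<open>The limit \<open>q i\<close> is written as
    \<open>v i *\<^sub>R b i + n i\<close>: a term with vanishing weight goes entirely into
    \<open>n i\<close>, any other into \<open>v i *\<^sub>R b i\<close>.\<close>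
  define b where "b i = (if v i = 0 then 0 else (1 / v i) *\<^sub>R q i)" for i
  define n where "n i = (if v i = 0 then q i else 0)" for i
  have inv: "(\<lambda>k. 1 / u (r k) i) \<longlonglongrightarrow> 1 / v i" and ev: "\<forall>\<^sub>F k in sequentially. u (r k) i > 0"
    if "i \<in> I" "0 < v i" for i
    using v[OF that(1)] that(2) by (auto intro!: tendsto_divide tendsto_const order_tendstoD)
  show ?thesis
  proof (rule that[OF r])
    show "0 \<le> v i" if "i \<in> I" for i
      using v_nonneg[OF that] .
    show "sum v I = 1"
      using v_sum .
    have "(\<Sum>i\<in>I. v i *\<^sub>R b i + n i) = sum q I"
      by (intro sum.cong) (auto simp: b_def n_def)
    also have "\<dots> = 0"
      using W_sum by (simp add: q_def flip: scaleR_sum_right)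
    finally show "(\<Sum>i\<in>I. v i *\<^sub>R b i + n i) = 0" .
    show "n i \<in> normal_cone (R i) x" if "i \<in> I" for i
      using q_le[OF that] x[OF that] by (auto simp: n_def normal_cone_def)
    show "(\<lambda>k. s (r k) i) \<longlonglongrightarrow> b i" if i: "i \<in> I" "0 < v i" for i
    proof (rule Lim_transform_eventually)
      show "(\<lambda>k. (1 / u (r k) i) *\<^sub>R (u (r k) i *\<^sub>R s (r k) i)) \<longlonglongrightarrow> b i"
        using tendsto_scaleR[OF inv[OF i] q_lim[OF i(1)]] i(2) by (simp add: b_def)
      show "\<forall>\<^sub>F k in sequentially. (1 / u (r k) i) *\<^sub>R (u (r k) i *\<^sub>R s (r k) i) = s (r k) i"
        using ev[OF i] by eventually_elim simp
    qed
    show "(\<lambda>k. c (r k) i) \<longlonglongrightarrow> 0" if i: "i \<in> I" "0 < v i" for i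
    proof (rule Lim_transform_eventually)
      show "(\<lambda>k. (1 / u (r k) i) * (u (r k) i * c (r k) i)) \<longlonglongrightarrow> 0"
        using tendsto_mult[OF inv[OF i] sub[OF uc[OF i(1)]]] by simp
      show "\<forall>\<^sub>F k in sequentially. (1 / u (r k) i) * (u (r k) i * c (r k) i) = c (r k) i"
        using ev[OF i] by eventually_elim simp
    qed
  qed
qed

section \<open>Multiplier rules for suprema of convex functions\<close>

lemma normal_cone_add:
  assumes "a \<in> normal_cone A x" "b \<in> normal_cone A x"
  shows "a + b \<in> normal_cone A x"
  using assms by (fastforce simp: normal_cone_def inner_add_left split: if_splits)

lemma normal_cone_scaleR:
  assumes "a \<in> normal_cone A x" "0 \<le> c"
  shows "c *\<^sub>R a \<in> normal_cone A x"
  using assms by (auto simp: normal_cone_def mult_nonneg_nonpos split: if_splits)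

lemma normal_cone_sum:
  assumes "x \<in> A" "\<And>i. i \<in> I \<Longrightarrow> n i \<in> normal_cone A x"
  shows "sum n I \<in> normal_cone A x"
  using assms by (auto simp: normal_cone_def inner_sum_left intro: sum_nonpos)

text \<open>A small step from \<open>z\<close> along \<open>w\<close> stays in \<open>A\<close> but
  would make the pairing with \<open>w\<close> positive unless \<open>w = 0\<close>.\<close>

lemma normal_cone_interior_eq_0:
  assumes w: "w \<in> normal_cone A x" and z: "z \<in> interior A" "0 \<le> w \<bullet> (z - x)"
  shows "w = 0"
proof (rule ccontr)
  assume "w \<noteq> 0"
  obtain e where e: "0 < e" "cball z e \<subseteq> A"
    using z(1) mem_interior_cball by blast
  have "z + (e / norm w) *\<^sub>R w \<in> A"
    using e \<open>w \<noteq> 0\<close> by (intro subsetD[OF e(2)]) (auto simp: dist_norm)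
  then have "w \<bullet> (z + (e / norm w) *\<^sub>R w - x) \<le> 0"
    using w by (auto simp: normal_cone_def split: if_splits)
  then have "w \<bullet> (z - x) + (e / norm w) * (w \<bullet> w) \<le> 0"
    by (simp add: inner_add_right inner_diff_right)
  moreover have "(e / norm w) * (w \<bullet> w) > 0"
    using e(1) \<open>w \<noteq> 0\<close> by simp
  ultimately show False
    using z(2) by simp
qed

text \<open>\<open>Q\<close> stands for the domain of the objective and \<open>P\<close> for that of
  the supremum of the constraints, where the values \<open>g t y\<close> are bounded in
  \<open>t\<close>. Keeping \<open>P\<close> apart from the possibly larger \<open>D t\<close> lets
  the rule cover restricted and unrestricted constraint functions alike. The vectors
  \<open>n0\<close> and \<open>n1\<close> collect what the terms with vanishing weight leave
  behind.\<close>

lemma sup_multiplier_rule: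
  fixes g0 :: "'a::euclidean_space \<Rightarrow> real" and g :: "'i \<Rightarrow> 'a \<Rightarrow> real"
    and Q P :: "'a set" and D :: "'i \<Rightarrow> 'a set" and T :: "'i set" and M :: "'a \<Rightarrow> real" and x :: 'a
  defines "A \<equiv> {s. (s, 0) \<in> affine_minorants Q g0 x}"
  defines "B \<equiv> \<Inter>\<epsilon>\<in>{0<..}. closure {s. \<exists>t\<in>T. (s, \<epsilon>) \<in> affine_minorants (D t) (g t) x}"
  assumes "T \<noteq> {}"
    and g0: "convex_on Q g0" and g: "\<And>t. t \<in> T \<Longrightarrow> convex_on (D t) (g t)"
    and PD: "\<And>t. t \<in> T \<Longrightarrow> P \<subseteq> D t"
    and x: "x \<in> Q" "x \<in> P" "g0 x \<le> 0" "\<And>t. t \<in> T \<Longrightarrow> g t x \<le> 0"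
    and M: "\<And>t y. t \<in> T \<Longrightarrow> y \<in> P \<Longrightarrow> g t y \<le> M y"
    and qual: "Q \<inter> interior P \<noteq> {}"
    and sup: "\<And>y e. y \<in> Q \<Longrightarrow> (\<And>t. t \<in> T \<Longrightarrow> y \<in> D t) \<Longrightarrow> 0 < e \<Longrightarrow> - e < g0 y \<or> (\<exists>t\<in>T. - e < g t y)"
  obtains \<alpha> \<beta> a b n0 n1 where "0 \<le> \<alpha>" "0 \<le> \<beta>" "\<alpha> + \<beta> = (1::real)"
    "\<alpha> = 0 \<or> a \<in> A" "\<beta> = 0 \<or> b \<in> convex hull B"
    "n0 \<in> normal_cone Q x" "n1 \<in> normal_cone P x" "\<alpha> *\<^sub>R a + \<beta> *\<^sub>R b + n0 + n1 = 0"
proof -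
  define G0 where "G0 = affine_minorants Q g0 x"
  define G1 where "G1 = (\<Union>t\<in>T. affine_minorants (D t) (g t) x)"
  define d where "d = DIM('a \<times> real) + 1"
  have convQ: "convex Q"
    using g0 by (simp add: convex_on_def)
  \<comment> \<open>\<open>interior P\<close> is open and meets \<open>Q\<close>, in which the
    relative interior is dense.\<close>
  have "rel_interior Q \<inter> interior P \<noteq> {}"
    using qual open_Int_closure_eq_empty[of "interior P" "rel_interior Q"]
      convex_closure_rel_interior[OF convQ] closure_subset[of Q] by (auto simp: Int_commute)
  then obtain z where zQ: "z \<in> rel_interior Q" and zP: "z \<in> interior P"
    by blast
  have zD: "z \<in> rel_interior (D t)" if "t \<in> T" for t
    using zP interior_mono[OF PD[OF that]] interior_subset_rel_interior by blast
  have xD: "x \<in> D t" if "t \<in> T" for t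
    using PD[OF that] x(2) by blast
  have "0 \<in> closure (convex hull (\<Union>j\<in>insert None (Some ` T).
      affine_minorants (case_option Q D j) (case_option g0 g j) x))"
  proof (rule zero_mem_closure_convex_hull_affine_minorants[where z = z and M = "max (g0 z) (M z)"])
    fix y and e :: real
    assume y: "\<And>j. j \<in> insert None (Some ` T) \<Longrightarrow> y \<in> case_option Q D j" and "0 < e"
    have "y \<in> Q" "\<And>t. t \<in> T \<Longrightarrow> y \<in> D t"
      using y[of None] y[of "Some _"] by auto
    from sup[OF this \<open>0 < e\<close>] show "\<exists>j\<in>insert None (Some ` T). - e < case_option g0 g j y"
      by auto
  next
    show "case_option g0 g j z \<le> max (g0 z) (M z)" if "j \<in> insert None (Some ` T)" for j
      using that M[OF _ subsetD[OF interior_subset zP]] by (cases j) (auto simp: le_max_iff_disj)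
  qed (use g0 g x xD zQ zD in auto)
  moreover have "(\<Union>j\<in>insert None (Some ` T). affine_minorants (case_option Q D j) (case_option g0 g j) x) = G0 \<union> G1"
    by (simp add: G0_def G1_def)
  ultimately have zero: "0 \<in> closure (convex hull (G0 \<union> G1))"
    by simp
  have cG0: "convex G0"
    by (simp add: G0_def convex_affine_minorants)
  have ne0: "G0 \<noteq> {}"
    using affine_minorants_exact[OF g0 zQ] unfolding G0_def by (metis empty_iff)
  have ne1: "convex hull G1 \<noteq> {}"
  proof -
    obtain t where t: "t \<in> T"
      using \<open>T \<noteq> {}\<close> by blast
    obtain s where "(s, s \<bullet> (z - x) - g t z) \<in> affine_minorants (D t) (g t) x"
      using affine_minorants_exact[OF g[OF t] zD[OF t]] by metis
    with t show ?thesis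
      by (auto simp: G1_def)
  qed
  \<comment> \<open>Position \<open>0\<close> holds the objective, for which convexity of
    \<open>G0\<close> allows a single term; the \<open>d\<close> constraint terms supplied by
    Caratheodory's theorem sit at the successors.\<close>
  define comb where "comb k u q \<longleftrightarrow> (\<forall>i<Suc d. 0 \<le> u i) \<and> q 0 \<in> G0 \<and> (\<forall>i. q (Suc i) \<in> G1) \<and> sum u {..<Suc d} = 1 \<and>
      norm (\<Sum>i<Suc d. u i *\<^sub>R q i) < 1 / (real k + 1)" for k :: nat and u q
  have "\<forall>k. \<exists>u q. comb k u q"
  proof
    fix k
    obtain p where p: "p \<in> convex hull (G0 \<union> G1)" and small: "dist p 0 < 1 / (real k + 1)"
      using zero closure_approachable[of 0] by (metis of_nat_0_le_iff add_nonneg_pos zero_less_one zero_less_divide_1_iff)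
    have "p \<in> convex hull (G0 \<union> convex hull G1)"
      using p by (simp add: hull_Un_right[symmetric])
    then obtain l m p0 p1 where lm: "0 \<le> l" "0 \<le> m" "l + m = 1" "p0 \<in> G0" "p1 \<in> convex hull G1"
      "p = l *\<^sub>R p0 + m *\<^sub>R p1"
      unfolding convex_hull_union_two[OF cG0 ne0 convex_convex_hull ne1] by blast
    obtain u q where u: "\<And>i. i < d \<Longrightarrow> 0 \<le> u i" "\<And>i. q i \<in> G1" "sum u {..<d} = 1" "(\<Sum>i<d. u i *\<^sub>R q i) = p1"
      using convex_hull_caratheodory_indexed[OF lm(5)] unfolding d_def by metis
    have "(\<forall>i<Suc d. 0 \<le> case_nat l (\<lambda>i. m * u i) i)"
      using lm u by (auto split: nat.split)
    moreover have "sum (case_nat l (\<lambda>i. m * u i)) {..<Suc d} = 1"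
      unfolding sum.lessThan_Suc_shift using lm u(3) by (simp flip: sum_distrib_left)
    moreover have "(\<Sum>i<Suc d. case_nat l (\<lambda>i. m * u i) i *\<^sub>R case_nat p0 q i) = p"
      unfolding sum.lessThan_Suc_shift using lm(6) u(4) by (simp flip: scaleR_scaleR scaleR_sum_right)
    ultimately show "\<exists>u q. comb k u q"
      using small lm(4) u(2) unfolding comb_def
      by (intro exI[of _ "case_nat l (\<lambda>i. m * u i)"] exI[of _ "case_nat p0 q"]) (simp del: sum.lessThan_Suc)
  qed
  from choice[OF this] obtain u where "\<forall>k. \<exists>q. comb k (u k) q"
    by blast
  from choice[OF this] obtain q where "comb k (u k) (q k)" for k
    by blast
  then have u: "\<And>k i. i < Suc d \<Longrightarrow> 0 \<le> u k i" "\<And>k. sum (u k) {..<Suc d} = 1"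
    and q: "\<And>k. q k 0 \<in> G0" "\<And>k i. q k (Suc i) \<in> G1"
    and small: "\<And>k. norm (\<Sum>i<Suc d. u k i *\<^sub>R q k i) < 1 / (real k + 1)"
    unfolding comb_def by blast+
  have lim: "(\<lambda>k. \<Sum>i<Suc d. u k i *\<^sub>R q k i) \<longlonglongrightarrow> 0"
    using small by (intro LIMSEQ_norm_0) (simp add: add.commute)
  define R where "R i = (if i = 0 then Q else P)" for i :: nat
  have q0: "fst (q k 0) \<bullet> (y - x) - snd (q k 0) \<le> g0 y" if "y \<in> Q" for k y
    using q(1)[of k] that by (auto simp: G0_def affine_minorants_def)
  have q1: "\<exists>t\<in>T. (fst (q k (Suc i)), snd (q k (Suc i))) \<in> affine_minorants (D t) (g t) x" for k i
    using q(2)[of k i] by (auto simp: G1_def)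
  obtain r :: "nat \<Rightarrow> nat" and v b n where v: "\<And>i. i \<in> {..<Suc d} \<Longrightarrow> 0 \<le> v i" "sum v {..<Suc d} = 1"
    and zero: "(\<Sum>i<Suc d. v i *\<^sub>R b i + n i) = 0"
    and n: "\<And>i. i \<in> {..<Suc d} \<Longrightarrow> n i \<in> normal_cone (R i) x"
    and b: "\<And>i. i \<in> {..<Suc d} \<Longrightarrow> 0 < v i \<Longrightarrow> (\<lambda>k. fst (q (r k) i)) \<longlonglongrightarrow> b i"
    and c: "\<And>i. i \<in> {..<Suc d} \<Longrightarrow> 0 < v i \<Longrightarrow> (\<lambda>k. snd (q (r k) i)) \<longlonglongrightarrow> 0"
  proof (rule affine_minorant_combination_limit[of "{..<Suc d}" x R "\<lambda>k i. fst (q k i)" "\<lambda>k i. snd (q k i)"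
        "\<lambda>i y. if i = 0 then g0 y else M y" u])
    show "fst (q k i) \<bullet> (y - x) - snd (q k i) \<le> (if i = 0 then g0 y else M y)"
      if "i \<in> {..<Suc d}" "y \<in> R i" for k i y
    proof (cases i)
      case (Suc j)
      then have "y \<in> P"
        using that by (simp add: R_def)
      moreover obtain t where t: "t \<in> T" "(fst (q k i), snd (q k i)) \<in> affine_minorants (D t) (g t) x"
        using q1 Suc by blast
      ultimately have "fst (q k i) \<bullet> (y - x) - snd (q k i) \<le> g t y"
        using PD[OF t(1)] by (auto simp: affine_minorants_def)
      with M[OF t(1) \<open>y \<in> P\<close>] Suc show ?thesis
        by simp
    qed (use that q0 in \<open>simp add: R_def\<close>)
    show "0 \<le> snd (q k i)" for k i
    proof (cases i)
      case 0
      then show ?thesis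
        using q0[OF x(1), of k] x(3) by simp
    next
      case (Suc j)
      then obtain t where t: "t \<in> T" "(fst (q k i), snd (q k i)) \<in> affine_minorants (D t) (g t) x"
        using q1 by blast
      show ?thesis
        using affine_minorants_nonneg[OF t(2) xD x(4)] t(1) by simp
    qed
    \<comment> \<open>Pairing with \<open>z - x\<close> gives nonpositive numbers with sum
      \<open>0\<close>, hence all are \<open>0\<close>. As \<open>z\<close> is interior to
      \<open>P\<close>, the constraint vectors vanish, and then so does the remaining
      \<open>w 0\<close>.\<close>
    show "\<forall>i\<in>{..<Suc d}. w i = 0" if w: "\<And>i. i \<in> {..<Suc d} \<Longrightarrow> w i \<in> normal_cone (R i) x"
      and w0: "sum w {..<Suc d} = 0" for w
    proof -
      have zR: "z \<in> R i" for i
        using zQ zP interior_subset rel_interior_subset by (fastforce simp: R_def)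
      have "w i \<bullet> (z - x) \<le> 0" if "i \<in> {..<Suc d}" for i
        using w[OF that] zR[of i] by (auto simp: normal_cone_def split: if_splits)
      moreover have "(\<Sum>i<Suc d. w i \<bullet> (z - x)) = 0"
        unfolding inner_sum_left[symmetric] w0 by simp
      ultimately have eq: "w i \<bullet> (z - x) = 0" if "i \<in> {..<Suc d}" for i
        using sum_nonneg_eq_0_iff[of "{..<Suc d}" "\<lambda>i. - (w i \<bullet> (z - x))"] that
        by (simp add: sum_negf del: sum.lessThan_Suc)
      have pos: "w (Suc i) = 0" if "i < d" for i
        using w[of "Suc i"] eq[of "Suc i"] that
        by (intro normal_cone_interior_eq_0[OF _ zP]) (auto simp: R_def)
      then have "w 0 = 0"
        using w0 unfolding sum.lessThan_Suc_shift by simp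
      with pos show ?thesis
        by (metis lessThan_iff Suc_less_SucD not0_implies_Suc)
    qed
    show "(\<lambda>k. \<Sum>i<Suc d. u k i *\<^sub>R fst (q k i)) \<longlonglongrightarrow> 0"
      using tendsto_fst[OF lim] by (simp add: fst_sum del: sum.lessThan_Suc)
    show "(\<lambda>k. \<Sum>i<Suc d. u k i * snd (q k i)) \<longlonglongrightarrow> 0"
      using tendsto_snd[OF lim] by (simp add: snd_sum del: sum.lessThan_Suc)
  qed (use x u in \<open>auto simp: R_def simp del: sum.lessThan_Suc\<close>)
  have bA: "b 0 \<in> A" if "0 < v 0"
    unfolding A_def affine_minorants_def
  proof safe
    fix y assume y: "y \<in> Q"
    have "(\<lambda>k. fst (q (r k) 0) \<bullet> (y - x) - snd (q (r k) 0)) \<longlonglongrightarrow> b 0 \<bullet> (y - x) - 0"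
      using that by (intro tendsto_diff tendsto_inner tendsto_const b c) auto
    then show "b 0 \<bullet> (y - x) - 0 \<le> g0 y"
      by (rule LIMSEQ_le_const2) (use q0[OF y] in auto)
  qed
  \<comment> \<open>The offsets tend to \<open>0\<close> and may be enlarged to
    \<open>\<epsilon>\<close>, so for each fixed \<open>\<epsilon>\<close> the slopes eventually lie
    in the set whose closure is taken.\<close>
  have bB: "b (Suc i) \<in> B" if i: "i < d" "0 < v (Suc i)" for i
    unfolding B_def
  proof (rule INT_I)
    fix \<epsilon> :: real
    assume "\<epsilon> \<in> {0<..}"
    then have "\<forall>\<^sub>F k in sequentially. snd (q (r k) (Suc i)) < \<epsilon>"
      using c[of "Suc i"] i by (intro order_tendstoD(2)) auto
    then have "\<forall>\<^sub>F k in sequentially. fst (q (r k) (Suc i)) \<in> {s. \<exists>t\<in>T. (s, \<epsilon>) \<in> affine_minorants (D t) (g t) x}"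
      by eventually_elim (use q1 affine_minorants_mono in \<open>blast intro: less_imp_le\<close>)
    then have "\<forall>\<^sub>F k in sequentially. fst (q (r k) (Suc i)) \<in> closure {s. \<exists>t\<in>T. (s, \<epsilon>) \<in> affine_minorants (D t) (g t) x}"
      by (rule eventually_mono) (rule subsetD[OF closure_subset])
    then show "b (Suc i) \<in> closure {s. \<exists>t\<in>T. (s, \<epsilon>) \<in> affine_minorants (D t) (g t) x}"
      by (rule Lim_in_closed_set[OF closed_closure]) (use b[of "Suc i"] i in auto)
  qed
  define \<beta> where "\<beta> = (\<Sum>i<d. v (Suc i))"
  \<comment> \<open>For \<open>\<beta> = 0\<close> division by zero makes \<open>b'\<close> equal to
    \<open>0\<close>. All constraint weights are then \<open>0\<close> by
    \<open>\<beta>_zero\<close>, so \<open>\<beta> *\<^sub>R b'\<close> is still the weighted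
    sum.\<close>
  define b' where "b' = (1 / \<beta>) *\<^sub>R (\<Sum>i<d. v (Suc i) *\<^sub>R b (Suc i))"
  have vS: "0 \<le> v (Suc i)" if "i < d" for i
    using v(1) that by simp
  have \<beta>_zero: "v (Suc i) = 0" if "\<beta> = 0" "i < d" for i
    using that vS sum_nonneg_eq_0_iff[of "{..<d}" "\<lambda>i. v (Suc i)"] by (simp add: \<beta>_def)
  show ?thesis
  proof (rule that[of "v 0" \<beta> "b 0" b' "n 0" "\<Sum>i<d. n (Suc i)"])
    show "0 \<le> v 0" and \<beta>: "0 \<le> \<beta>"
      using v(1) by (auto simp: \<beta>_def intro: sum_nonneg)
    show "v 0 + \<beta> = 1"
      using v(2) unfolding \<beta>_def sum.lessThan_Suc_shift .
    show "v 0 = 0 \<or> b 0 \<in> A"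
      using bA v(1)[of 0] by fastforce
    show "n 0 \<in> normal_cone Q x"
      using n[of 0] by (simp add: R_def)
    show "(\<Sum>i<d. n (Suc i)) \<in> normal_cone P x"
      using n[of "Suc _"] x(2) by (intro normal_cone_sum) (auto simp: R_def)
    have "\<beta> *\<^sub>R b' = (\<Sum>i<d. v (Suc i) *\<^sub>R b (Suc i))"
      using \<beta>_zero by (cases "\<beta> = 0") (auto simp: b'_def)
    then show "v 0 *\<^sub>R b 0 + \<beta> *\<^sub>R b' + n 0 + (\<Sum>i<d. n (Suc i)) = 0"
      using zero unfolding sum.lessThan_Suc_shift by (simp add: sum.distrib algebra_simps)
    have "b' \<in> convex hull B" if "0 < \<beta>"
    proof -
      let ?I = "{i. i < d \<and> 0 < v (Suc i)}"
      have eq: "v (Suc i) = 0" if "i \<in> {..<d} - ?I" for i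
        using that vS[of i] by auto
      have "(\<Sum>i\<in>?I. (v (Suc i) / \<beta>) *\<^sub>R b (Suc i)) \<in> convex hull B"
      proof (rule convex_sum)
        have "(\<Sum>i\<in>?I. v (Suc i)) = \<beta>"
          unfolding \<beta>_def using eq by (intro sum.mono_neutral_left) auto
        then show "(\<Sum>i\<in>?I. v (Suc i) / \<beta>) = 1"
          using that by (simp flip: sum_divide_distrib)
      qed (use that bB in \<open>auto intro: hull_inc\<close>)
      also have "(\<Sum>i\<in>?I. (v (Suc i) / \<beta>) *\<^sub>R b (Suc i)) = (\<Sum>i<d. (v (Suc i) / \<beta>) *\<^sub>R b (Suc i))"
        using eq by (intro sum.mono_neutral_left) auto
      also have "\<dots> = b'"
        by (simp add: b'_def scaleR_sum_right)
      finally show ?thesis .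
    qed
    then show "\<beta> = 0 \<or> b' \<in> convex hull B"
      using \<beta> by fastforce
  qed
qed

text \<open>On \<open>D\<close> a normal vector contributes a nonpositive amount. This is how normal
  vectors left over in the limit are absorbed into sets of subgradients.\<close>

lemma affine_minorants_add_normal_cone:
  assumes "(s, a) \<in> affine_minorants D g x" "n \<in> normal_cone D x"
  shows "(n + s, a) \<in> affine_minorants D g x"
  unfolding affine_minorants_def
proof safe
  fix y assume "y \<in> D"
  with assms have "s \<bullet> (y - x) - a \<le> g y" "n \<bullet> (y - x) \<le> 0"
    by (auto simp: affine_minorants_def normal_cone_def split: if_splits)
  then show "(n + s) \<bullet> (y - x) - a \<le> g y"
    by (simp add: inner_add_left)
qed

text \<open>Translation by \<open>n\<close> sends each set under the closure into itself and
  commutes with closure and convex hull. It absorbs the leftover normal vector when the objective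
  has weight \<open>0\<close>.\<close>

lemma normal_cone_plus_hull_active_slopes:
  fixes g :: "'i \<Rightarrow> 'a::euclidean_space \<Rightarrow> real" and D :: "'a set" and T :: "'i set" and x :: 'a
  defines "B \<equiv> \<Inter>\<epsilon>\<in>{0<..}. closure {s. \<exists>t\<in>T. (s, \<epsilon>) \<in> affine_minorants D (g t) x}"
  assumes n: "n \<in> normal_cone D x" and b: "b \<in> convex hull B"
  shows "n + b \<in> convex hull B"
proof -
  let ?E = "\<lambda>\<epsilon>. {s. \<exists>t\<in>T. (s, \<epsilon>) \<in> affine_minorants D (g t) x}"
  have "(+) n ` closure (?E \<epsilon>) \<subseteq> closure (?E \<epsilon>)" for \<epsilon>
    unfolding closure_translation[symmetric]
    using affine_minorants_add_normal_cone[OF _ n] by (intro closure_mono) blast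
  then have "(+) n ` B \<subseteq> B"
    unfolding B_def by blast
  then have "convex hull ((+) n ` B) \<subseteq> convex hull B"
    by (rule hull_mono)
  then show ?thesis
    using b unfolding convex_hull_translation by blast
qed

text \<open>Each generating slope satisfies the inequality up to \<open>\<epsilon>\<close>, and
  closed half-spaces persist under closure, intersection and convex hull. At a Slater point
  \<open>m\<close> can be taken negative, which keeps \<open>0\<close> out of the hull.\<close>

lemma hull_active_slopes_le:
  fixes g :: "'i \<Rightarrow> 'a::euclidean_space \<Rightarrow> real"
  assumes b: "b \<in> convex hull (\<Inter>\<epsilon>\<in>{0<..}. closure {s. \<exists>t\<in>T. (s, \<epsilon>) \<in> affine_minorants (D t) (g t) x})"
    (is "b \<in> convex hull ?B")
    and y: "\<And>t. t \<in> T \<Longrightarrow> y \<in> D t" "\<And>t. t \<in> T \<Longrightarrow> g t y \<le> m"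
  shows "b \<bullet> (y - x) \<le> m"
proof -
  have "?B \<subseteq> {s. (y - x) \<bullet> s \<le> m}"
  proof safe
    fix s assume s: "s \<in> ?B"
    show "(y - x) \<bullet> s \<le> m"
    proof (rule field_le_epsilon)
      fix \<epsilon> :: real
      assume \<epsilon>: "0 < \<epsilon>"
      have "{s. \<exists>t\<in>T. (s, \<epsilon>) \<in> affine_minorants (D t) (g t) x} \<subseteq> {s. (y - x) \<bullet> s \<le> m + \<epsilon>}"
        using y by (fastforce simp: affine_minorants_def inner_commute)
      then have "closure {s. \<exists>t\<in>T. (s, \<epsilon>) \<in> affine_minorants (D t) (g t) x} \<subseteq> {s. (y - x) \<bullet> s \<le> m + \<epsilon>}"
        by (intro closure_minimal closed_halfspace_le)
      with s \<epsilon> show "(y - x) \<bullet> s \<le> m + \<epsilon>"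
        by auto
    qed
  qed
  then have "convex hull ?B \<subseteq> {s. (y - x) \<bullet> s \<le> m}"
    by (intro hull_minimal convex_halfspace_le)
  with b show ?thesis
    by (auto simp: inner_commute)
qed

text \<open>After translating \<open>x\<close> to the origin, \<open>h\<close> is a linear
  projection onto the span of the translated set.\<close>

lemma affine_retraction_affine_hull:
  fixes D :: "'a::euclidean_space set"
  assumes "x \<in> D"
  obtains h where "\<And>y. y \<in> D \<Longrightarrow> h y = y" "\<And>y. h y \<in> affine hull D" "continuous_on UNIV h"
    "\<And>y z u v. u + v = 1 \<Longrightarrow> h (u *\<^sub>R y + v *\<^sub>R z) = u *\<^sub>R h y + v *\<^sub>R h z"
proof -
  let ?V = "span ((\<lambda>y. - x + y) ` (D - {x}))"
  obtain \<pi> :: "'a \<Rightarrow> 'a" where \<pi>: "range \<pi> \<subseteq> ?V" "linear \<pi>" "\<And>v. v \<in> ?V \<Longrightarrow> \<pi> v = v"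
    using linear_exists_left_inverse_on[OF linear_id subspace_span, of "(\<lambda>y. - x + y) ` (D - {x})"] by auto
  show ?thesis
  proof (rule that[of "\<lambda>y. x + \<pi> (y - x)"])
    show "x + \<pi> (y - x) = y" if "y \<in> D" for y
    proof -
      have "- x + y \<in> ?V"
        using that by (cases "y = x") (auto intro: span_base simp: span_zero)
      from \<pi>(3)[OF this] show ?thesis
        by simp
    qed
    show "x + \<pi> (y - x) \<in> affine hull D" for y
      using \<pi>(1) unfolding affine_hull_span2[OF assms] by auto
    show "continuous_on UNIV (\<lambda>y. x + \<pi> (y - x))"
      by (intro continuous_on_add continuous_on_const
          linear_continuous_on_compose[OF continuous_on_diff[OF continuous_on_id continuous_on_const] \<pi>(2)])
    show "x + \<pi> (u *\<^sub>R y + v *\<^sub>R z - x) = u *\<^sub>R (x + \<pi> (y - x)) + v *\<^sub>R (x + \<pi> (z - x))"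
      if "u + v = 1" for y z u v
    proof -
      have x: "u *\<^sub>R x + v *\<^sub>R x = x"
        using that by (simp flip: scaleR_left.add)
      then have "u *\<^sub>R y + v *\<^sub>R z - x = u *\<^sub>R (y - x) + v *\<^sub>R (z - x)"
        by (simp add: scaleR_diff_right algebra_simps)
      then have "\<pi> (u *\<^sub>R y + v *\<^sub>R z - x) = u *\<^sub>R \<pi> (y - x) + v *\<^sub>R \<pi> (z - x)"
        by (simp only: linear_add[OF \<pi>(2)] linear_scale[OF \<pi>(2)])
      then have "x + \<pi> (u *\<^sub>R y + v *\<^sub>R z - x) = (u *\<^sub>R x + v *\<^sub>R x) + (u *\<^sub>R \<pi> (y - x) + v *\<^sub>R \<pi> (z - x))"
        by (simp only: x)
      then show ?thesis
        by (simp only: scaleR_add_right add_ac)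
    qed
  qed
qed

text \<open>With one domain for all functions, every leftover normal vector is normal to that domain
  and is absorbed into \<open>A\<close> or into the hull of \<open>B\<close>, so none appears in the
  conclusion.\<close>

lemma sup_multiplier_rule_common_domain:
  fixes g0 :: "'a::euclidean_space \<Rightarrow> real" and g :: "'i \<Rightarrow> 'a \<Rightarrow> real"
    and D :: "'a set" and T :: "'i set" and M :: "'a \<Rightarrow> real" and x :: 'a
  defines "A \<equiv> {s. (s, 0) \<in> affine_minorants D g0 x}"
  defines "B \<equiv> \<Inter>\<epsilon>\<in>{0<..}. closure {s. \<exists>t\<in>T. (s, \<epsilon>) \<in> affine_minorants D (g t) x}"
  assumes ne: "T \<noteq> {}"
    and g0: "convex_on D g0" and g: "\<And>t. t \<in> T \<Longrightarrow> convex_on D (g t)"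
    and x: "x \<in> D" "g0 x \<le> 0" "\<And>t. t \<in> T \<Longrightarrow> g t x \<le> 0"
    and M: "\<And>t y. t \<in> T \<Longrightarrow> y \<in> D \<Longrightarrow> g t y \<le> M y"
    and sup: "\<And>y e. y \<in> D \<Longrightarrow> 0 < e \<Longrightarrow> - e < g0 y \<or> (\<exists>t\<in>T. - e < g t y)"
  obtains \<alpha> \<beta> a b where "0 \<le> \<alpha>" "0 \<le> \<beta>" "\<alpha> + \<beta> = (1::real)"
    "\<alpha> = 0 \<or> a \<in> A" "\<beta> = 0 \<or> b \<in> convex hull B" "\<alpha> *\<^sub>R a + \<beta> *\<^sub>R b = 0"
proof -
  obtain h where h: "\<And>y. y \<in> D \<Longrightarrow> h y = y" "\<And>y. h y \<in> affine hull D" "continuous_on UNIV h"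
    "\<And>y z u v. u + v = 1 \<Longrightarrow> h (u *\<^sub>R y + v *\<^sub>R z) = u *\<^sub>R h y + v *\<^sub>R h z"
    using affine_retraction_affine_hull[OF x(1)] by metis
  \<comment> \<open>Extending all functions constantly along the fibres of \<open>h\<close> gives their common domain a nonempty
    interior without creating new minorants on \<open>D\<close>.\<close>
  define D' where "D' = {y. h y \<in> D}"
  have DD': "D \<subseteq> D'"
    using h(1) by (auto simp: D'_def)
  have convD: "convex D"
    using g0 by (simp add: convex_on_def)
  have conv: "convex_on D' (\<lambda>y. k (h y))" if "convex_on D k" for k
    using that unfolding convex_on_def convex_def D'_def by (simp add: h(4))
  have minor: "(s, a) \<in> affine_minorants D k x" if "(s, a) \<in> affine_minorants D' (\<lambda>y. k (h y)) x" for s a k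
    unfolding affine_minorants_def
  proof safe
    fix y assume y: "y \<in> D"
    then have "s \<bullet> (y - x) - a \<le> k (h y)"
      using that DD' by (auto simp: affine_minorants_def)
    then show "s \<bullet> (y - x) - a \<le> k y"
      by (simp add: h(1)[OF y])
  qed
  have ncone: "n \<in> normal_cone D x" if "n \<in> normal_cone D' x" for n
    using that DD' x(1) by (auto simp: normal_cone_def split: if_splits)
  obtain z where z: "z \<in> rel_interior D"
    using rel_interior_eq_empty[OF convD] x(1) by blast
  then obtain e where e: "0 < e" "ball z e \<inter> affine hull D \<subseteq> D" and zD: "z \<in> D"
    unfolding mem_rel_interior_ball by blast
  \<comment> \<open>\<open>h\<close> maps into the affine hull, where a ball around \<open>z\<close>
    lies in \<open>D\<close>; the preimage of that ball is an open neighbourhood of \<open>z\<close>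
    inside \<open>D'\<close>.\<close>
  have "z \<in> interior D'"
  proof (rule interiorI)
    show "open (h -` ball z e)"
      using h(3) by (intro open_vimage) auto
    show "z \<in> h -` ball z e"
      using h(1)[OF zD] e(1) by simp
    show "h -` ball z e \<subseteq> D'"
      using e(2) h(2) by (auto simp: D'_def)
  qed
  then have qual: "D' \<inter> interior D' \<noteq> {}"
    using interior_subset by blast
  have xD': "x \<in> D'" and x': "g0 (h x) \<le> 0" "t \<in> T \<Longrightarrow> g t (h x) \<le> 0" for t
    using x DD' h(1) by auto
  have M': "g t (h y) \<le> M (h y)" if "t \<in> T" "y \<in> D'" for t y
    using M that by (simp add: D'_def)
  have sup': "- e < g0 (h y) \<or> (\<exists>t\<in>T. - e < g t (h y))"
    if "y \<in> D'" "\<And>t. t \<in> T \<Longrightarrow> y \<in> D'" "0 < e" for y e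
    using sup that(1,3) by (simp add: D'_def)
  obtain \<alpha> \<beta> a b n0 n1 where \<alpha>\<beta>: "0 \<le> \<alpha>" "0 \<le> \<beta>" "\<alpha> + \<beta> = (1::real)"
    and a: "\<alpha> = 0 \<or> a \<in> {s. (s, 0) \<in> affine_minorants D' (\<lambda>y. g0 (h y)) x}"
    and b: "\<beta> = 0 \<or> b \<in> convex hull
      (\<Inter>\<epsilon>\<in>{0<..}. closure {s. \<exists>t\<in>T. (s, \<epsilon>) \<in> affine_minorants D' (\<lambda>y. g t (h y)) x})"
    and n: "n0 \<in> normal_cone D' x" "n1 \<in> normal_cone D' x"
    and eq: "\<alpha> *\<^sub>R a + \<beta> *\<^sub>R b + n0 + n1 = 0"
    by (rule sup_multiplier_rule[OF ne conv[OF g0] conv[OF g] subset_refl xD' xD' x' M' qual sup'])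
  define n where "n = n0 + n1"
  have n: "n \<in> normal_cone D x"
    unfolding n_def using n ncone by (intro normal_cone_add) auto
  have a': "\<alpha> = 0 \<or> a \<in> A"
    using a minor by (auto simp: A_def)
  have "(\<Inter>\<epsilon>\<in>{0<..}. closure {s. \<exists>t\<in>T. (s, \<epsilon>) \<in> affine_minorants D' (\<lambda>y. g t (h y)) x}) \<subseteq> B"
    unfolding B_def using minor by (intro INT_anti_mono closure_mono subset_refl) blast
  from hull_mono[OF this] b have b': "\<beta> = 0 \<or> b \<in> convex hull B"
    by blast
  show ?thesis
  \<comment> \<open>For \<open>\<alpha> = 0\<close> the vector \<open>n\<close> joins
    \<open>b\<close>, whose weight is then \<open>1\<close>; otherwise it joins \<open>a\<close>,
    rescaled by \<open>1 / \<alpha>\<close>.\<close>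
  proof (cases "\<alpha> = 0")
    case True
    then have "n + b \<in> convex hull B"
      using normal_cone_plus_hull_active_slopes[OF n] b' \<alpha>\<beta> unfolding B_def by simp
    moreover have "n + b = 0"
      using True \<alpha>\<beta> eq by (simp add: n_def algebra_simps)
    ultimately show ?thesis
      using that[of 0 1 a "n + b"] by simp
  next
    case False
    then have "(1 / \<alpha>) *\<^sub>R n + a \<in> A"
      using affine_minorants_add_normal_cone[OF _ normal_cone_scaleR[OF n]] a' \<alpha>\<beta> by (auto simp: A_def)
    moreover have "\<alpha> *\<^sub>R ((1 / \<alpha>) *\<^sub>R n + a) + \<beta> *\<^sub>R b = 0"
      using eq False by (simp add: n_def scaleR_add_right algebra_simps)
    ultimately show ?thesis
      using that[OF \<alpha>\<beta> _ b'] by blast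
  qed
qed

section \<open>Extended-real functions\<close>

lemma proper_fun_finite:
  assumes "proper_fun h" "y \<in> edom h"
  shows "ereal (real_of_ereal (h y)) = h y"
proof -
  have "h y \<noteq> - \<infinity>" "h y \<noteq> \<infinity>"
    using assms by (auto simp: proper_fun_def edom_def)
  then show ?thesis
    by (cases "h y") auto
qed

lemma mem_edom_if_le_ereal:
  assumes "h y \<le> ereal r"
  shows "y \<in> edom h"
  using assms by (cases "h y") (auto simp: edom_def)

lemma convex_fun_real_le:
  assumes h: "proper_fun h" "convex_fun h" and yz: "y \<in> edom h" "z \<in> edom h"
    and uv: "0 \<le> u" "0 \<le> v" "u + v = 1"
  shows "u *\<^sub>R y + v *\<^sub>R z \<in> edom h"
    and "real_of_ereal (h (u *\<^sub>R y + v *\<^sub>R z)) \<le> u * real_of_ereal (h y) + v * real_of_ereal (h z)"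
proof -
  let ?w = "u *\<^sub>R y + v *\<^sub>R z"
  have "h ?w \<le> ereal u * h y + ereal v * h z"
    using h(2) uv unfolding convex_fun_def by blast
  also have "\<dots> = ereal (u * real_of_ereal (h y) + v * real_of_ereal (h z))"
    using proper_fun_finite[OF h(1) yz(1)] proper_fun_finite[OF h(1) yz(2)]
    by (simp flip: plus_ereal.simps(1) times_ereal.simps(1))
  finally have le: "h ?w \<le> ereal (u * real_of_ereal (h y) + v * real_of_ereal (h z))" .
  then show *: "?w \<in> edom h"
    by (rule mem_edom_if_le_ereal)
  show "real_of_ereal (h ?w) \<le> u * real_of_ereal (h y) + v * real_of_ereal (h z)"
    using le proper_fun_finite[OF h(1) *] by (simp flip: ereal_less_eq(3))
qed

lemma convex_on_real_of_convex_fun: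
  assumes "proper_fun h" "convex_fun h" "convex D" "D \<subseteq> edom h"
  shows "convex_on D (\<lambda>y. real_of_ereal (h y))"
  unfolding convex_on_def using assms(3)
  by (intro conjI ballI allI impI convex_fun_real_le(2)[OF assms(1,2)] subsetD[OF assms(4)])

lemma convex_edom:
  assumes "proper_fun h" "convex_fun h"
  shows "convex (edom h)"
  by (intro convexI convex_fun_real_le(1)[OF assms])

lemma le_sup_fun:
  assumes "t \<in> T"
  shows "f t y \<le> sup_fun T f y"
  unfolding sup_fun_def using assms by (rule SUP_upper)

lemma edom_sup_fun_subset:
  assumes "t \<in> T"
  shows "edom (sup_fun T f) \<subseteq> edom (f t)"
  unfolding edom_def by (intro Collect_mono impI) (rule le_less_trans[OF le_sup_fun[OF assms]])

lemma sup_fun_finite: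
  assumes "t \<in> T" "proper_fun (f t)" "y \<in> edom (sup_fun T f)"
  shows "ereal (real_of_ereal (sup_fun T f y)) = sup_fun T f y"
proof -
  have "f t y \<le> sup_fun T f y"
    using assms(1) by (rule le_sup_fun)
  moreover have "f t y \<noteq> - \<infinity>"
    using assms(2) by (simp add: proper_fun_def)
  ultimately have "sup_fun T f y \<noteq> - \<infinity>"
    by auto
  moreover have "sup_fun T f y \<noteq> \<infinity>"
    using assms(3) by (simp add: edom_def)
  ultimately show ?thesis
    by (cases "sup_fun T f y") auto
qed

lemma real_le_sup_fun:
  assumes "t \<in> T" "proper_fun (f t)" "y \<in> edom (sup_fun T f)"
  shows "real_of_ereal (f t y) \<le> real_of_ereal (sup_fun T f y)"
proof -
  have "f t y \<le> sup_fun T f y"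
    using assms(1) by (rule le_sup_fun)
  moreover have "y \<in> edom (f t)"
    using assms(3) by (rule subsetD[OF edom_sup_fun_subset[OF assms(1)]])
  ultimately show ?thesis
    using proper_fun_finite[OF assms(2)] sup_fun_finite[OF assms] by (simp flip: ereal_less_eq(3))
qed

lemma convex_edom_sup_fun:
  assumes f: "\<And>t. t \<in> T \<Longrightarrow> proper_fun (f t)" "\<And>t. t \<in> T \<Longrightarrow> convex_fun (f t)"
  shows "convex (edom (sup_fun T f))"
proof (rule convexI)
  let ?F = "sup_fun T f"
  fix y z and u v :: real
  assume yz: "y \<in> edom ?F" "z \<in> edom ?F" and uv: "0 \<le> u" "0 \<le> v" "u + v = 1"
  have "f t (u *\<^sub>R y + v *\<^sub>R z) \<le> ereal (u * real_of_ereal (?F y) + v * real_of_ereal (?F z))" if t: "t \<in> T" for t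
  proof -
    have yzt: "y \<in> edom (f t)" "z \<in> edom (f t)"
      by (rule subsetD[OF edom_sup_fun_subset[OF t]], rule yz)+
    note w = convex_fun_real_le[OF f(1)[OF t] f(2)[OF t] yzt uv]
    have "real_of_ereal (f t (u *\<^sub>R y + v *\<^sub>R z)) \<le> u * real_of_ereal (f t y) + v * real_of_ereal (f t z)"
      by (rule w(2))
    also have "\<dots> \<le> u * real_of_ereal (?F y) + v * real_of_ereal (?F z)"
      using uv real_le_sup_fun[where f = f, OF t f(1)[OF t]] yz by (intro add_mono mult_left_mono) auto
    finally show ?thesis
      using proper_fun_finite[OF f(1)[OF t] w(1)] by (simp flip: ereal_less_eq(3))
  qed
  then have "?F (u *\<^sub>R y + v *\<^sub>R z) \<le> ereal (u * real_of_ereal (?F y) + v * real_of_ereal (?F z))"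
    unfolding sup_fun_def by (rule SUP_least)
  then show "u *\<^sub>R y + v *\<^sub>R z \<in> edom ?F"
    by (rule mem_edom_if_le_ereal)
qed

lemma isCont_mem_interior_edom:
  fixes F :: "'a::t2_space \<Rightarrow> ereal"
  assumes "isCont F z" "z \<in> edom F"
  shows "z \<in> interior (edom F)"
proof -
  have "\<forall>\<^sub>F y in at z. F y < \<infinity>"
  proof (rule order_tendstoD(2))
    show "(F \<longlongrightarrow> F z) (at z)"
      using assms(1) by (simp add: isCont_def)
    show "F z < \<infinity>"
      using assms(2) unfolding edom_def by blast
  qed
  then obtain S where "open S" "z \<in> S" "\<forall>y\<in>S. y \<noteq> z \<longrightarrow> F y < \<infinity>"
    unfolding eventually_at_topological by blast
  moreover from this assms(2) have "S \<subseteq> edom F"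
    by (auto simp: edom_def)
  ultimately show ?thesis
    by (intro interiorI)
qed

lemma eps_subdiff_add_ind_funI:
  assumes h: "proper_fun h" and x: "x \<in> edom h" "x \<in> C"
    and le: "\<And>y. y \<in> edom h \<Longrightarrow> y \<in> C \<Longrightarrow> s \<bullet> (y - x) - \<epsilon> \<le> real_of_ereal (h y) - real_of_ereal (h x)"
  shows "s \<in> eps_subdiff \<epsilon> (\<lambda>y. h y + ind_fun C y) x"
proof -
  obtain r where r: "h x = ereal r"
    using proper_fun_finite[OF h x(1)] by metis
  have "ereal r + ereal (s \<bullet> (y - x)) - ereal \<epsilon> \<le> h y + ind_fun C y" for y
  proof (cases "y \<in> edom h \<and> y \<in> C")
    case True
    then obtain q where q: "h y = ereal q"
      using proper_fun_finite[OF h] by metis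
    with le[of y] True r show ?thesis
      by (simp add: ind_fun_def)
  next
    case False
    then have eq: "h y + ind_fun C y = \<infinity>"
      using h by (auto simp: ind_fun_def edom_def proper_fun_def)
    show ?thesis
      unfolding eq by simp
  qed
  then show ?thesis
    using x(2) r by (simp add: eps_subdiff_def ind_fun_def)
qed

lemma eps_subdiffI:
  assumes h: "proper_fun h" and x: "x \<in> edom h"
    and le: "\<And>y. y \<in> edom h \<Longrightarrow> s \<bullet> (y - x) - \<epsilon> \<le> real_of_ereal (h y) - real_of_ereal (h x)"
  shows "s \<in> eps_subdiff \<epsilon> h x"
  using eps_subdiff_add_ind_funI[of h x UNIV s \<epsilon>] assms by (simp add: ind_fun_def)

text \<open>The case \<open>c = 0\<close> puts no condition on \<open>b\<close>: the zero vector is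
  always in the cone, by convention if \<open>B = {}\<close>.\<close>

lemma scaleR_hull_mem_conical_hull:
  assumes "0 \<le> c" "c = 0 \<or> b \<in> convex hull B"
  shows "c *\<^sub>R b \<in> conical_hull B"
proof (cases "c = 0")
  case True
  show ?thesis
  proof (cases "B = {}")
    case False
    then obtain p where "p \<in> convex hull B"
      by fastforce
    then have "0 *\<^sub>R p \<in> {c *\<^sub>R x | c x. 0 \<le> c \<and> x \<in> convex hull B}"
      by blast
    then show ?thesis
      using True False by (simp add: conical_hull_def)
  qed (use True in \<open>simp add: conical_hull_def\<close>)
next
  case False
  then have "B \<noteq> {}"
    using assms(2) by auto
  then show ?thesis
    using False assms by (auto simp: conical_hull_def)
qed

section \<open>The optimality conditions\<close>

theorem proposition17:
  fixes T :: "'i set"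
    and f0 :: "real ^ 'n \<Rightarrow> ereal"
    and f :: "'i \<Rightarrow> real ^ 'n \<Rightarrow> ereal"
    and F :: "real ^ 'n \<Rightarrow> ereal"
    and xbar :: "real ^ 'n"
  assumes "T \<noteq> {}"
    and "proper_fun f0" and "convex_fun f0"
    and "\<And>t. t \<in> T \<Longrightarrow> proper_fun (f t)"
    and "\<And>t. t \<in> T \<Longrightarrow> convex_fun (f t)"
    and "F = sup_fun T f"
    and "optimal_solution T f0 f xbar"
    and "F xbar = 0"
  shows
    "0 \<in> convex hull
       (subdiff (\<lambda>x. f0 x + ind_fun (edom F) x) xbar \<union>
        (\<Inter>\<epsilon>\<in>{0<..}. closure (\<Union>t\<in>active_set T f \<epsilon> xbar.
           eps_subdiff \<epsilon> (\<lambda>x. f t x + ind_fun (edom F \<inter> edom f0) x) xbar)))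
     \<and>
     ((\<exists>x0\<in>edom f0. F x0 < 0) \<longrightarrow>
       0 \<in> subdiff (\<lambda>x. f0 x + ind_fun (edom F) x) xbar +
           conical_hull (\<Inter>\<epsilon>\<in>{0<..}. closure (\<Union>t\<in>active_set T f \<epsilon> xbar.
             eps_subdiff \<epsilon> (\<lambda>x. f t x + ind_fun (edom F \<inter> edom f0) x) xbar)))
     \<and>
     ((\<exists>x0\<in>edom f0. F x0 < 0) \<and> (\<exists>z\<in>edom f0 \<inter> edom F. isCont F z) \<longrightarrow>
       0 \<in> subdiff f0 xbar +
           conical_hull (\<Inter>\<epsilon>\<in>{0<..}. closure (\<Union>t\<in>active_set T f \<epsilon> xbar.
             eps_subdiff \<epsilon> (f t) xbar)) +
           normal_cone (edom F) xbar)"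
    (is "0 \<in> convex hull (?A \<union> ?B) \<and> (?slater \<longrightarrow> 0 \<in> ?A + conical_hull ?B) \<and>
      (?slater \<and> ?cont \<longrightarrow> 0 \<in> subdiff f0 xbar + conical_hull ?B' + normal_cone (edom F) xbar)")
proof -
  note f = assms(4,5)
  define g0 where "g0 y = real_of_ereal (f0 y) - real_of_ereal (f0 xbar)" for y
  define g where "g t y = real_of_ereal (f t y)" for t y
  define M where "M y = real_of_ereal (F y)" for y
  define D where "D = edom F \<inter> edom f0"
  have opt: "\<And>t. t \<in> T \<Longrightarrow> f t xbar \<le> 0" "xbar \<in> edom f0"
    "\<And>y. (\<And>t. t \<in> T \<Longrightarrow> f t y \<le> 0) \<Longrightarrow> f0 xbar \<le> f0 y"
    using assms(7) by (auto simp: optimal_solution_def feasible_set_def)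
  have xF: "xbar \<in> edom F"
    using assms(8) by (simp add: edom_def)
  have Ff: "edom F \<subseteq> edom (f t)" if "t \<in> T" for t
    unfolding assms(6) using that by (rule edom_sup_fun_subset)
  have fin: "f t y = ereal (g t y)" if "t \<in> T" "y \<in> edom (f t)" for t y
    using proper_fun_finite[OF f(1)] that unfolding g_def by metis
  obtain t0 where t0: "t0 \<in> T"
    using assms(1) by blast
  have finF: "F y = ereal (M y)" if "y \<in> edom F" for y
    using sup_fun_finite[where f = f, OF t0 f(1)[OF t0]] that unfolding M_def assms(6) by simp
  have gM: "g t y \<le> M y" if "t \<in> T" "y \<in> edom F" for t y
    using real_le_sup_fun[where f = f, OF that(1) f(1)] that unfolding g_def M_def assms(6) by simp
  have finx: "f t xbar = ereal (g t xbar)" if "t \<in> T" for t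
    by (rule fin[OF that subsetD[OF Ff[OF that] xF]])
  have gx: "g t xbar \<le> 0" if "t \<in> T" for t
    using opt(1)[OF that] finx[OF that] by simp
  \<comment> \<open>A feasible \<open>y\<close> has objective value at least that of
    \<open>xbar\<close>; any other \<open>y\<close> violates a constraint, whose value is then
    positive.\<close>
  have sup: "- e < g0 y \<or> (\<exists>t\<in>T. - e < g t y)"
    if "y \<in> edom f0" "\<And>t. t \<in> T \<Longrightarrow> y \<in> edom (f t)" "0 < e" for y e
  proof (cases "\<forall>t\<in>T. f t y \<le> 0")
    case True
    then have "f0 xbar \<le> f0 y"
      using opt(3) by blast
    then have "ereal (real_of_ereal (f0 xbar)) \<le> ereal (real_of_ereal (f0 y))"
      by (simp only: proper_fun_finite[OF assms(2)] that(1) opt(2))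
    then have "g0 y \<ge> 0"
      by (simp add: g0_def)
    with that(3) show ?thesis
      by simp
  next
    case False
    then obtain t where t: "t \<in> T" "\<not> f t y \<le> 0"
      by blast
    then have "0 < g t y"
      using fin[OF t(1) that(2)[OF t(1)]] by simp
    with that(3) t(1) show ?thesis
      by (intro disjI2 bexI[of _ t]) auto
  qed
  \<comment> \<open>Evaluating the minorant at \<open>xbar\<close> gives
    \<open>- \<epsilon> \<le> g t xbar\<close>, so approximate activity comes with the
    offset.\<close>
  have active: "t \<in> active_set T f \<epsilon> xbar"
    if "t \<in> T" "(s, \<epsilon>) \<in> affine_minorants C (g t) xbar" "xbar \<in> C" for t s \<epsilon> C
  proof -
    have "- \<epsilon> \<le> g t xbar"
      using that by (force simp: affine_minorants_def)
    then have "F xbar - ereal \<epsilon> \<le> f t xbar"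
      using finx[OF that(1)] assms(8) by simp
    with that(1) show ?thesis
      by (simp add: active_set_def assms(6))
  qed
  have minor_le: "s \<bullet> (y - xbar) - \<epsilon> \<le> real_of_ereal (f t y) - real_of_ereal (f t xbar)"
    if "t \<in> T" "(s, \<epsilon>) \<in> affine_minorants C (g t) xbar" "y \<in> C" for t s \<epsilon> C y
  proof -
    have "s \<bullet> (y - xbar) - \<epsilon> \<le> g t y"
      using that by (simp add: affine_minorants_def)
    with gx[OF that(1)] show ?thesis
      unfolding g_def by linarith
  qed
  \<comment> \<open>Every element of the hull strictly descends from \<open>xbar\<close> towards a
    Slater point. \<open>C\<close> stays general because both the common domain and the domains of
    the \<open>f t\<close> are inserted for it.\<close>
  have slater: "c \<bullet> (x0 - xbar) < 0"
    if "x0 \<in> edom f0" "F x0 < 0" "\<And>t. t \<in> T \<Longrightarrow> x0 \<in> C t"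
      "c \<in> convex hull (\<Inter>\<epsilon>\<in>{0<..}. closure {s. \<exists>t\<in>T. (s, \<epsilon>) \<in> affine_minorants (C t) (g t) xbar})" for x0 c C
  proof -
    have x0: "x0 \<in> edom F"
      using that(2) by (auto simp: edom_def)
    have "c \<bullet> (x0 - xbar) \<le> M x0"
      using hull_active_slopes_le[OF that(4)] that(3) gM x0 by blast
    moreover have "M x0 < 0"
      using that(2) finF[OF x0] by simp
    ultimately show ?thesis
      by simp
  qed

  \<comment> \<open>\<open>D\<close> is the effective domain of the restricted objective and of
    every restricted constraint, so the common-domain rule yields the first two claims.\<close>
  have convD: "convex D"
    unfolding D_def assms(6) using assms(2-5) by (intro convex_Int convex_edom_sup_fun convex_edom)
  have g0D: "convex_on D g0"
    using convex_on_add[OF convex_on_real_of_convex_fun[OF assms(2,3) convD]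
        convex_on_const[THEN iffD2, OF convD, of "- real_of_ereal (f0 xbar)"]]
    by (simp add: g0_def[abs_def] D_def)
  have gD: "convex_on D (g t)" if "t \<in> T" for t
    using convex_on_real_of_convex_fun[OF f(1)[OF that] f(2)[OF that] convD] Ff[OF that]
    by (auto simp: g_def[abs_def] D_def)
  have xD: "xbar \<in> D"
    using xF opt(2) by (simp add: D_def)
  have supD: "- e < g0 y \<or> (\<exists>t\<in>T. - e < g t y)" if "y \<in> D" "0 < e" for y e
    using sup[OF _ _ that(2), of y] that(1) Ff unfolding D_def by blast
  have gMD: "g t y \<le> M y" if "t \<in> T" "y \<in> D" for t y
    using gM that by (simp add: D_def)
  have g0x: "g0 xbar \<le> 0"
    by (simp add: g0_def)
  define A1 where "A1 = {s. (s, 0) \<in> affine_minorants D g0 xbar}"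
  define B1 where "B1 = (\<Inter>\<epsilon>\<in>{0<..}. closure {s. \<exists>t\<in>T. (s, \<epsilon>) \<in> affine_minorants D (g t) xbar})"
  obtain \<alpha> \<beta> a b where \<alpha>\<beta>: "0 \<le> \<alpha>" "0 \<le> \<beta>" "\<alpha> + \<beta> = (1::real)"
    and a1: "\<alpha> = 0 \<or> a \<in> A1" and b1: "\<beta> = 0 \<or> b \<in> convex hull B1" and eq: "\<alpha> *\<^sub>R a + \<beta> *\<^sub>R b = 0"
    unfolding A1_def B1_def
    by (rule sup_multiplier_rule_common_domain[OF assms(1) g0D gD xD g0x gx gMD supD])
  have "A1 \<subseteq> ?A"
    using opt(2) xF assms(2) unfolding subdiff_def
    by (auto intro!: eps_subdiff_add_ind_funI simp: A1_def affine_minorants_def D_def g0_def)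
  with a1 have a: "\<alpha> = 0 \<or> a \<in> ?A"
    by blast
  have "{s. \<exists>t\<in>T. (s, \<epsilon>) \<in> affine_minorants D (g t) xbar} \<subseteq> (\<Union>t\<in>active_set T f \<epsilon> xbar.
      eps_subdiff \<epsilon> (\<lambda>x. f t x + ind_fun (edom F \<inter> edom f0) x) xbar)" for \<epsilon>
  proof safe
    fix s t assume t: "t \<in> T" and s: "(s, \<epsilon>) \<in> affine_minorants D (g t) xbar"
    have "s \<in> eps_subdiff \<epsilon> (\<lambda>x. f t x + ind_fun (edom F \<inter> edom f0) x) xbar"
      using f(1)[OF t] Ff[OF t] xF xD minor_le[OF t s] by (intro eps_subdiff_add_ind_funI) (auto simp: D_def)
    with active[OF t s xD] show "s \<in> (\<Union>t\<in>active_set T f \<epsilon> xbar.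
      eps_subdiff \<epsilon> (\<lambda>x. f t x + ind_fun (edom F \<inter> edom f0) x) xbar)"
      by blast
  qed
  then have "B1 \<subseteq> ?B"
    unfolding B1_def by (intro INT_anti_mono closure_mono subset_refl)
  from hull_mono[OF this] b1 have b: "\<beta> = 0 \<or> b \<in> convex hull ?B"
    by blast

  have "0 \<in> convex hull (?A \<union> ?B)"
  proof -
    have bU: "b \<in> convex hull (?A \<union> ?B)" if "b \<in> convex hull ?B"
      using that hull_mono[of ?B "?A \<union> ?B"] by blast
    have aU: "a \<in> convex hull (?A \<union> ?B)" if "a \<in> ?A"
      using that by (simp add: hull_inc)
    \<comment> \<open>\<open>a\<close> and \<open>b\<close> are known to lie in their sets only for
      nonzero weights, so degenerate weights are treated apart.\<close>
    consider "\<alpha> = 0" "\<beta> = 1" | "\<beta> = 0" "\<alpha> = 1" | "\<alpha> \<noteq> 0" "\<beta> \<noteq> 0"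
      using \<alpha>\<beta> by fastforce
    then show ?thesis
    proof cases
      case 1
      with bU b eq show ?thesis by simp
    next
      case 2
      with aU a eq show ?thesis by simp
    next
      case 3
      then have "\<alpha> *\<^sub>R a + \<beta> *\<^sub>R b \<in> convex hull (?A \<union> ?B)"
        using aU bU a b \<alpha>\<beta> by (intro convexD[OF convex_convex_hull]) blast+
      then show ?thesis
        unfolding eq .
    qed
  qed
  moreover have "0 \<in> ?A + conical_hull ?B" if slater_point: ?slater
  proof -
    obtain x0 where x0: "x0 \<in> edom f0" "F x0 < 0"
      using slater_point by blast
    then have "x0 \<in> D"
      by (auto simp: D_def edom_def)
    have "\<alpha> \<noteq> 0"
    proof
      assume "\<alpha> = 0"
      with \<alpha>\<beta> eq b1 have "0 \<in> convex hull B1"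
        by simp
      then show False
        using slater[OF x0, of "\<lambda>_. D" 0] \<open>x0 \<in> D\<close> by (simp add: B1_def)
    qed
    then have "a + (\<beta> / \<alpha>) *\<^sub>R b = (1 / \<alpha>) *\<^sub>R (\<alpha> *\<^sub>R a + \<beta> *\<^sub>R b)"
      by (simp add: scaleR_add_right)
    then have "a + (\<beta> / \<alpha>) *\<^sub>R b = 0"
      by (simp add: eq)
    moreover have "(\<beta> / \<alpha>) *\<^sub>R b \<in> conical_hull ?B"
      using \<alpha>\<beta> b \<open>\<alpha> \<noteq> 0\<close> by (intro scaleR_hull_mem_conical_hull) auto
    moreover have "a \<in> ?A"
      using a \<open>\<alpha> \<noteq> 0\<close> by blast
    ultimately show ?thesis
      using set_plus_intro[of a ?A "(\<beta> / \<alpha>) *\<^sub>R b" "conical_hull ?B"] by (simp only:)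
  qed
  moreover have "0 \<in> subdiff f0 xbar + conical_hull ?B' + normal_cone (edom F) xbar"
    if slater_point: ?slater and cont: ?cont
  proof -
    obtain x0 where x0: "x0 \<in> edom f0" "F x0 < 0"
      using slater_point by blast
    then have x0F: "x0 \<in> edom F"
      by (auto simp: edom_def)
    have qual: "edom f0 \<inter> interior (edom F) \<noteq> {}"
      using cont isCont_mem_interior_edom by blast
    define A2 where "A2 = {s. (s, 0) \<in> affine_minorants (edom f0) g0 xbar}"
    define B2 where "B2 = (\<Inter>\<epsilon>\<in>{0<..}. closure {s. \<exists>t\<in>T. (s, \<epsilon>) \<in> affine_minorants (edom (f t)) (g t) xbar})"
    have conv0: "convex_on (edom f0) g0"
      using convex_on_add[OF convex_on_real_of_convex_fun[OF assms(2,3) convex_edom[OF assms(2,3)] subset_refl]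
          convex_on_const[THEN iffD2, OF convex_edom[OF assms(2,3)], of "- real_of_ereal (f0 xbar)"]]
      by (simp add: g0_def[abs_def])
    have conv: "convex_on (edom (f t)) (g t)" if "t \<in> T" for t
      using convex_on_real_of_convex_fun[OF f(1)[OF that] f(2)[OF that] convex_edom[OF f(1)[OF that] f(2)[OF that]]]
      by (simp add: g_def[abs_def])
    obtain \<alpha> \<beta> a b n0 n1 where \<alpha>\<beta>: "0 \<le> \<alpha>" "0 \<le> \<beta>" "\<alpha> + \<beta> = (1::real)"
      and a: "\<alpha> = 0 \<or> a \<in> A2" and b: "\<beta> = 0 \<or> b \<in> convex hull B2"
      and n: "n0 \<in> normal_cone (edom f0) xbar" "n1 \<in> normal_cone (edom F) xbar"
      and eq: "\<alpha> *\<^sub>R a + \<beta> *\<^sub>R b + n0 + n1 = 0"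
      unfolding A2_def B2_def
      by (rule sup_multiplier_rule[OF assms(1) conv0 conv Ff opt(2) xF g0x gx gM qual sup])
    \<comment> \<open>With \<open>\<alpha> = 0\<close> the pairing with \<open>x0 - xbar\<close>
      would be negative for \<open>b\<close> and nonpositive for both normal vectors, yet the three
      vectors sum to \<open>0\<close>.\<close>
    have "\<alpha> \<noteq> 0"
    proof
      assume "\<alpha> = 0"
      with \<alpha>\<beta> b have "b \<in> convex hull B2"
        by simp
      then have "b \<bullet> (x0 - xbar) < 0"
        using slater[OF x0, of "\<lambda>t. edom (f t)" b] Ff x0F unfolding B2_def by blast
      moreover have "n0 \<bullet> (x0 - xbar) \<le> 0" "n1 \<bullet> (x0 - xbar) \<le> 0"
        using n x0(1) x0F by (auto simp: normal_cone_def split: if_splits)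
      moreover have "(b + n0 + n1) \<bullet> (x0 - xbar) = 0"
        using eq \<open>\<alpha> = 0\<close> \<alpha>\<beta> by simp
      ultimately show False
        by (simp add: inner_add_left)
    qed
    then have "\<alpha> > 0"
      using \<alpha>\<beta> by simp
    \<comment> \<open>\<open>n0\<close> is normal to the domain of \<open>f0\<close> and is absorbed
      into its subdifferential. \<open>n1\<close> is normal to \<open>edom F\<close>, which may be
      smaller than the domains of the \<open>f t\<close>, and remains as the normal-cone
      term.\<close>
    have "(1 / \<alpha>) *\<^sub>R n0 + a \<in> A2"
      using affine_minorants_add_normal_cone[OF _ normal_cone_scaleR[OF n(1)]] a \<open>\<alpha> > 0\<close> by (auto simp: A2_def)
    also have "A2 \<subseteq> subdiff f0 xbar"
      using opt(2) assms(2) unfolding subdiff_def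
      by (auto intro!: eps_subdiffI simp: A2_def affine_minorants_def g0_def)
    finally have a: "(1 / \<alpha>) *\<^sub>R n0 + a \<in> subdiff f0 xbar" .
    have "{s. \<exists>t\<in>T. (s, \<epsilon>) \<in> affine_minorants (edom (f t)) (g t) xbar} \<subseteq>
        (\<Union>t\<in>active_set T f \<epsilon> xbar. eps_subdiff \<epsilon> (f t) xbar)" for \<epsilon>
    proof safe
      fix s t assume t: "t \<in> T" and s: "(s, \<epsilon>) \<in> affine_minorants (edom (f t)) (g t) xbar"
      have "xbar \<in> edom (f t)"
        using Ff[OF t] xF by blast
      moreover from this have "s \<in> eps_subdiff \<epsilon> (f t) xbar"
        using f(1)[OF t] minor_le[OF t s] by (intro eps_subdiffI)
      ultimately show "s \<in> (\<Union>t\<in>active_set T f \<epsilon> xbar. eps_subdiff \<epsilon> (f t) xbar)"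
        using active[OF t s] by blast
    qed
    then have "B2 \<subseteq> ?B'"
      unfolding B2_def by (intro INT_anti_mono closure_mono subset_refl)
    from hull_mono[OF this] b have "\<beta> / \<alpha> = 0 \<or> b \<in> convex hull ?B'"
      by auto
    then have "(\<beta> / \<alpha>) *\<^sub>R b \<in> conical_hull ?B'"
      using \<alpha>\<beta> by (intro scaleR_hull_mem_conical_hull) auto
    moreover have "(1 / \<alpha>) *\<^sub>R n1 \<in> normal_cone (edom F) xbar"
      using \<alpha>\<beta>(1) by (intro normal_cone_scaleR n) auto
    ultimately have "(1 / \<alpha>) *\<^sub>R n0 + a + (\<beta> / \<alpha>) *\<^sub>R b + (1 / \<alpha>) *\<^sub>R n1
        \<in> subdiff f0 xbar + conical_hull ?B' + normal_cone (edom F) xbar"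
      using a by (intro set_plus_intro)
    moreover have "(1 / \<alpha>) *\<^sub>R n0 + a + (\<beta> / \<alpha>) *\<^sub>R b + (1 / \<alpha>) *\<^sub>R n1
        = (1 / \<alpha>) *\<^sub>R (\<alpha> *\<^sub>R a + \<beta> *\<^sub>R b + n0 + n1)"
      using \<open>\<alpha> \<noteq> 0\<close> by (simp add: scaleR_add_right add_ac)
    ultimately show ?thesis
      unfolding eq by simp
  qed
  ultimately show ?thesis
    by blast
qed

end
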